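(* Let $\Sigma$ be a shifted simplicial complex of dimension $d$. Then for each $0\le i\le d$, $$\mathbf S^{ud}_{i-1}(\Sigma)\ \overset{\circ}{=}\ \{\uparrow^{d-i}z(S,T)\colon (S,T)\in\mathrm{LSG}(\Sigma_i)\}$$ (as multisets), where $\Sigma_i$ is regarded as a family of $(i+1)$-element sets.
   Context: Shifted complex: a simplicial complex $\Sigma$ on vertex set an integer interval $[p,q]$ such that whenever $i<j$ are vertices, $F\in\Sigma$, $i\notin F$, $j\in F$, then $(F\setminus\{j\})\cup\{i\}\in\Sigma$. $\Sigma_i$ = set of $i$-dimensional faces. Weights: $\Bbbk$ is the field of rational functions over $\mathbb C$ in indeterminates $x_{a,j}$ ($a\ge1$, $j\in\mathbb Z$); $X_{a,j}=x_{a,j}^2$. For a finite multiset of integers $S=\{i_1\le\cdots\le i_m\}$, $x_S=x_{1,i_1}x_{2,i_2}\cdots x_{m,i_m}$, $X_S=x_S^2$, $x_\emptyset=1$. The raising operator $\uparrow$ is the substitution $x_{a,j}\mapsto x_{a+1,j}$ extended multiplicatively and additively (the paper also sets $\uparrow x_{d+1,j}=0$, which does not affect the quantities here); $\uparrow^a$ is its $a$-th iterate, applied elementwise to multisets. Algebraic fine weighting: for a complex $\Omega$ of dimension $e$ with integer vertices, $C_i(\Omega)$ is the $\Bbbk$-space with basis $[F]$, $F\in\Omega_i$ (including $[\emptyset]$ in degree $-1$). For $j\in F$, $\varepsilon(j,F)=(-1)^{k+1}$ if $j$ is the $k$-th smallest element of $F$. The boundary map $\boldsymbol\partial_{\Omega,i}:C_i\to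 C_{i-1}$ is $[F]\mapsto\sum_{j\in F}\varepsilon(j,F)\frac{\uparrow^{e-i}(x_F)}{\uparrow^{e-i+1}(x_{F\setminus j})}[F\setminus j]$, $\boldsymbol\partial^*$ its transpose, $\mathbf L^{ud}_{\Omega,i}=\boldsymbol\partial_{\Omega,i+1}\boldsymbol\partial^*_{\Omega,i+1}$, and $\mathbf S^{ud}_i(\Omega)$ is its multiset of eigenvalues (in an algebraic closure of $\Bbbk$). For multisets, $\mathbf a\overset{\circ}{=}\mathbf b$ means they agree except possibly in the multiplicity of $0$. $z$-polynomials: for finite multisets $S,T$ of integers, $z(S,T)=\frac{1}{\uparrow X_S}\sum_{j\in T}X_{S\cup j}$ (multiset union). Critical pairs: for a family $\mathcal F$ of $k$-element sets of integers, let $p_{\mathcal F}$ be the smallest integer occurring in a member. A critical pair is $(A,B)$ with $A=\{a_1<\cdots<a_k\}\in\mathcal F$, $B\notin\mathcal F$, and $B=\{a_1,\dots,a_{i-1},a_i+1,a_{i+1},\dots,a_k\}$ a $k$-set for some $i$ ($B$ need not consist of vertices). Its long signature is $\mathrm{lsg}(A,B)=(\{a_1,\dots,a_{i-1}\},\{j\in\mathbb Z: p_{\mathcal F}\le j\le a_i\})$, and $\mathrm{LSG}(\mathcal F)$ is the multiset of long signatures of all critical pairs. *)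

theory Defs
  imports
    "HOL-Library.Multiset"
    "HOL-Library.Poly_Mapping"
    "HOL-Computational_Algebra.Fraction_Field"
    "HOL-Computational_Algebra.Polynomial"
    "HOL-Algebra.Algebraic_Closure_Type"
    "Jordan_Normal_Form.Char_Poly"
begin

section \<open>The field of rational functions\<close>

text \<open>
  \<open>Idx a j\<close> is the index of the indeterminate \<open>x\<^bsub>a+1,j\<^esub>\<close>: the indeterminates are
  indexed by \<open>a \<ge> 1\<close>, and the offset avoids a junk indeterminate for \<open>a = 0\<close>.
  The lexicographic order only serves to make the polynomial ring an instance of \<^class>\<open>idom\<close>.
\<close>

datatype idx = Idx nat int

instantiation idx :: linorder
begin

fun less_eq_idx :: "idx \<Rightarrow> idx \<Rightarrow> bool" where
  "less_eq_idx (Idx a j) (Idx b k) \<longleftrightarrow> a < b \<or> (a = b \<and> j \<le> k)"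

definition less_idx :: "idx \<Rightarrow> idx \<Rightarrow> bool" where
  "less_idx u v \<longleftrightarrow> u \<le> v \<and> \<not> v \<le> u"

instance
proof
  fix u v w :: idx
  show "u < v \<longleftrightarrow> u \<le> v \<and> \<not> v \<le> u" by (rule less_idx_def)
  show "u \<le> u" by (cases u) simp
  show "u \<le> v \<Longrightarrow> v \<le> w \<Longrightarrow> u \<le> w" by (cases u; cases v; cases w) auto
  show "u \<le> v \<Longrightarrow> v \<le> u \<Longrightarrow> u = v" by (cases u; cases v) auto
  show "u \<le> v \<or> v \<le> u" by (cases u; cases v) auto
qed

end

type_synonym monomial = "idx \<Rightarrow>\<^sub>0 nat"
type_synonym mpoly = "monomial \<Rightarrow>\<^sub>0 complex"
type_synonym ratfun = "mpoly fract"

text \<open>Only used with \<open>a \<ge> 1\<close>.\<close>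

definition indet :: "nat \<Rightarrow> int \<Rightarrow> ratfun" where
  "indet a j = Fract (Poly_Mapping.single (Poly_Mapping.single (Idx (a - 1) j) 1) 1) 1"


subsection \<open>The raising operator\<close>

fun raise_idx :: "idx \<Rightarrow> idx" where
  "raise_idx (Idx a j) = Idx (Suc a) j"

definition raise_mon :: "monomial \<Rightarrow> monomial" where
  "raise_mon m = (\<Sum>v\<in>Poly_Mapping.keys m.
     Poly_Mapping.single (raise_idx v) (Poly_Mapping.lookup m v))"

definition raise_poly :: "mpoly \<Rightarrow> mpoly" where
  "raise_poly f = (\<Sum>m\<in>Poly_Mapping.keys f.
     Poly_Mapping.single (raise_mon m) (Poly_Mapping.lookup f m))"

lemma raise_idx_eq_iff [simp]: "raise_idx u = raise_idx v \<longleftrightarrow> u = v"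
  by (cases u; cases v) auto

lemma raise_mon_superset:
  assumes "finite A" "Poly_Mapping.keys m \<subseteq> A"
  shows "raise_mon m = (\<Sum>v\<in>A. Poly_Mapping.single (raise_idx v) (Poly_Mapping.lookup m v))"
  unfolding raise_mon_def using assms
  by (intro sum.mono_neutral_left) (auto simp: in_keys_iff)

lemma raise_poly_superset:
  assumes "finite A" "Poly_Mapping.keys f \<subseteq> A"
  shows "raise_poly f = (\<Sum>m\<in>A. Poly_Mapping.single (raise_mon m) (Poly_Mapping.lookup f m))"
  unfolding raise_poly_def using assms
  by (intro sum.mono_neutral_left) (auto simp: in_keys_iff)

lemma raise_mon_0 [simp]: "raise_mon 0 = 0"
  by (simp add: raise_mon_def)

lemma raise_mon_single [simp]:
  "raise_mon (Poly_Mapping.single v n) = Poly_Mapping.single (raise_idx v) n"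
  by (subst raise_mon_superset[of "{v}"]) auto

lemma raise_mon_add: "raise_mon (m + n) = raise_mon m + raise_mon n"
proof -
  define A where "A = Poly_Mapping.keys m \<union> Poly_Mapping.keys n"
  have A: "finite A" "Poly_Mapping.keys m \<subseteq> A" "Poly_Mapping.keys n \<subseteq> A"
    "Poly_Mapping.keys (m + n) \<subseteq> A"
    using Poly_Mapping.keys_add[of m n] by (auto simp: A_def)
  show ?thesis
    by (simp add: raise_mon_superset[OF A(1,2)] raise_mon_superset[OF A(1,3)]
        raise_mon_superset[OF A(1,4)] lookup_add single_add sum.distrib)
qed

lemma lookup_raise_mon: "Poly_Mapping.lookup (raise_mon m) (raise_idx v) = Poly_Mapping.lookup m v"
proof -
  have "Poly_Mapping.lookup (raise_mon m) (raise_idx v) =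
      (\<Sum>u\<in>Poly_Mapping.keys m. if u = v then Poly_Mapping.lookup m v else 0)"
    unfolding raise_mon_def lookup_sum
    by (intro sum.cong refl) (auto simp: lookup_single when_def)
  also have "\<dots> = Poly_Mapping.lookup m v"
    by (auto simp: in_keys_iff)
  finally show ?thesis .
qed

lemma raise_mon_eq_iff [simp]: "raise_mon m = raise_mon n \<longleftrightarrow> m = n"
  by (metis lookup_raise_mon poly_mapping_eqI)

lemma lookup_raise_poly: "Poly_Mapping.lookup (raise_poly f) (raise_mon m) = Poly_Mapping.lookup f m"
proof -
  have "Poly_Mapping.lookup (raise_poly f) (raise_mon m) =
      (\<Sum>u\<in>Poly_Mapping.keys f. if u = m then Poly_Mapping.lookup f m else 0)"
    unfolding raise_poly_def lookup_sum
    by (intro sum.cong refl) (auto simp: lookup_single when_def)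
  also have "\<dots> = Poly_Mapping.lookup f m"
    by (auto simp: in_keys_iff)
  finally show ?thesis .
qed

lemma raise_poly_0 [simp]: "raise_poly 0 = 0"
  by (simp add: raise_poly_def)

lemma raise_poly_eq_0_iff [simp]: "raise_poly f = 0 \<longleftrightarrow> f = 0"
  by (metis lookup_raise_poly lookup_zero poly_mapping_eqI raise_poly_0)

lemma raise_poly_single [simp]:
  "raise_poly (Poly_Mapping.single m c) = Poly_Mapping.single (raise_mon m) c"
  by (subst raise_poly_superset[of "{m}"]) auto

lemma raise_poly_1 [simp]: "raise_poly 1 = 1"
  using raise_poly_single[of 0 1] by (simp del: raise_poly_single)

lemma raise_poly_add: "raise_poly (f + g) = raise_poly f + raise_poly g"
proof -
  define A where "A = Poly_Mapping.keys f \<union> Poly_Mapping.keys g"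
  have A: "finite A" "Poly_Mapping.keys f \<subseteq> A" "Poly_Mapping.keys g \<subseteq> A"
    "Poly_Mapping.keys (f + g) \<subseteq> A"
    using Poly_Mapping.keys_add[of f g] by (auto simp: A_def)
  show ?thesis
    by (simp add: raise_poly_superset[OF A(1,2)] raise_poly_superset[OF A(1,3)]
        raise_poly_superset[OF A(1,4)] lookup_add single_add sum.distrib)
qed

lemma raise_poly_sum: "raise_poly (\<Sum>a\<in>A. f a) = (\<Sum>a\<in>A. raise_poly (f a))"
  by (induction A rule: infinite_finite_induct) (auto simp: raise_poly_add)

lemma mpoly_expansion:
  "f = (\<Sum>m\<in>Poly_Mapping.keys f. Poly_Mapping.single m (Poly_Mapping.lookup f m))"
proof (rule poly_mapping_eqI)
  fix m
  have "Poly_Mapping.lookup (\<Sum>m\<in>Poly_Mapping.keys f.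
          Poly_Mapping.single m (Poly_Mapping.lookup f m)) m =
      (\<Sum>u\<in>Poly_Mapping.keys f. if u = m then Poly_Mapping.lookup f m else 0)"
    unfolding lookup_sum
    by (intro sum.cong refl) (auto simp: lookup_single when_def)
  also have "\<dots> = Poly_Mapping.lookup f m"
    by (auto simp: in_keys_iff)
  finally show "Poly_Mapping.lookup f m = Poly_Mapping.lookup (\<Sum>m\<in>Poly_Mapping.keys f.
          Poly_Mapping.single m (Poly_Mapping.lookup f m)) m" by simp
qed

lemma raise_poly_mult: "raise_poly (f * g) = raise_poly f * raise_poly g"
proof -
  have "f * g = (\<Sum>m\<in>Poly_Mapping.keys f. \<Sum>n\<in>Poly_Mapping.keys g.
      Poly_Mapping.single (m + n) (Poly_Mapping.lookup f m * Poly_Mapping.lookup g n))"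
    by (subst mpoly_expansion[of f], subst mpoly_expansion[of g])
      (simp add: sum_product mult_single)
  then show ?thesis
    by (simp add: raise_poly_sum raise_mon_add raise_poly_def[of f] raise_poly_def[of g]
        sum_product mult_single)
qed

definition raise :: "ratfun \<Rightarrow> ratfun" where
  "raise u = (THE v. \<exists>f g. g \<noteq> 0 \<and> u = Fract f g \<and> v = Fract (raise_poly f) (raise_poly g))"

lemma raise_Fract:
  assumes "g \<noteq> 0"
  shows "raise (Fract f g) = Fract (raise_poly f) (raise_poly g)"
  unfolding raise_def
proof (rule the_equality)
  show "\<exists>f' g'. g' \<noteq> 0 \<and> Fract f g = Fract f' g' \<and>
      Fract (raise_poly f) (raise_poly g) = Fract (raise_poly f') (raise_poly g')"
    using assms by blast
next
  fix v assume "\<exists>f' g'. g' \<noteq> 0 \<and> Fract f g = Fract f' g' \<and> v = Fract (raise_poly f') (raise_poly g')"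
  then obtain f' g' where *: "g' \<noteq> 0" "Fract f g = Fract f' g'"
    "v = Fract (raise_poly f') (raise_poly g')" by blast
  then have "f * g' = f' * g"
    using assms by (simp add: eq_fract)
  then have "raise_poly f * raise_poly g' = raise_poly f' * raise_poly g"
    by (metis raise_poly_mult)
  then show "v = Fract (raise_poly f) (raise_poly g)"
    using * assms by (simp add: eq_fract)
qed

text \<open>\<^const>\<open>raise\<close> is the field endomorphism fixing constants with \<open>x\<^bsub>a,j\<^esub> \<mapsto> x\<^bsub>a+1,j\<^esub>\<close>.\<close>

lemma raise_indet: "a \<ge> 1 \<Longrightarrow> raise (indet a j) = indet (a + 1) j"
  by (simp add: indet_def raise_Fract)

lemma raise_const: "raise (Fract (Poly_Mapping.single 0 c) 1) = Fract (Poly_Mapping.single 0 c) 1"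
  by (simp add: raise_Fract)

lemma raise_0: "raise 0 = 0"
  by (simp add: Zero_fract_def raise_Fract)

lemma raise_1: "raise 1 = 1"
  by (simp add: One_fract_def raise_Fract)

lemma raise_add: "raise (u + v) = raise u + raise v"
  by (cases u; cases v) (simp add: raise_Fract raise_poly_add raise_poly_mult)

lemma raise_mult: "raise (u * v) = raise u * raise v"
  by (cases u; cases v) (simp add: raise_Fract raise_poly_mult)


section \<open>Weights and \<open>z\<close>-polynomials\<close>

text \<open>\<open>x\<^sub>S = x\<^bsub>1,i\<^sub>1\<^esub> \<cdots> x\<^bsub>m,i\<^sub>m\<^esub>\<close> for \<open>S = {i\<^sub>1 \<le> \<cdots> \<le> i\<^sub>m}\<close>; the list positions start at 0.\<close>

definition xwt :: "int multiset \<Rightarrow> ratfun" where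
  "xwt S = (\<Prod>k<size S. indet (k + 1) (sorted_list_of_multiset S ! k))"

definition Xwt :: "int multiset \<Rightarrow> ratfun" where
  "Xwt S = (xwt S)\<^sup>2"

definition zpoly :: "int multiset \<Rightarrow> int multiset \<Rightarrow> ratfun" where
  "zpoly S T = (1 / raise (Xwt S)) * (\<Sum>j\<in>#T. Xwt (S + {#j#}))"


section \<open>Shifted complexes\<close>

definition simplicial_complex :: "int set \<Rightarrow> int set set \<Rightarrow> bool" where
  "simplicial_complex V \<Omega> \<longleftrightarrow>
     finite V \<and> \<Omega> \<subseteq> Pow V \<and> {} \<in> \<Omega> \<and> (\<forall>F\<in>\<Omega>. \<forall>G. G \<subseteq> F \<longrightarrow> G \<in> \<Omega>)"

definition shifted_complex :: "int \<Rightarrow> int \<Rightarrow> int set set \<Rightarrow> bool" where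
  "shifted_complex p q \<Omega> \<longleftrightarrow> simplicial_complex {p..q} \<Omega> \<and>
     (\<forall>i\<in>{p..q}. \<forall>j\<in>{p..q}. \<forall>F\<in>\<Omega>.
        i < j \<and> i \<notin> F \<and> j \<in> F \<longrightarrow> (F - {j}) \<union> {i} \<in> \<Omega>)"

definition face_dim :: "int set \<Rightarrow> int" where
  "face_dim F = int (card F) - 1"

definition complex_dim :: "int set set \<Rightarrow> int" where
  "complex_dim \<Omega> = Max (face_dim ` \<Omega>)"

definition faces :: "int set set \<Rightarrow> int \<Rightarrow> int set set" where
  "faces \<Omega> i = {F \<in> \<Omega>. face_dim F = i}"


section \<open>Algebraically weighted Laplacians and their spectra\<close>

text \<open>
  An enumeration of the basis \<open>[F]\<close>, \<open>F \<in> \<Omega>\<^sub>i\<close>, of \<open>C\<^sub>i(\<Omega>)\<close>, used to write the operators as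
  matrices. The order is irrelevant: another choice conjugates the Laplacian by a permutation matrix.
\<close>

definition face_list :: "int set set \<Rightarrow> int \<Rightarrow> int set list" where
  "face_list \<Omega> i = (SOME Fs. distinct Fs \<and> set Fs = faces \<Omega> i)"

lemma face_list:
  assumes "simplicial_complex V \<Omega>"
  shows "distinct (face_list \<Omega> i)" "set (face_list \<Omega> i) = faces \<Omega> i"
proof -
  have "finite (faces \<Omega> i)"
    using assms by (auto simp: simplicial_complex_def faces_def intro: finite_subset[of _ "Pow V"])
  then have "\<exists>Fs. distinct Fs \<and> set Fs = faces \<Omega> i"
    using finite_distinct_list by blast
  then have "distinct (face_list \<Omega> i) \<and> set (face_list \<Omega> i) = faces \<Omega> i"
    unfolding face_list_def by (rule someI_ex)
  then show "distinct (face_list \<Omega> i)" "set (face_list \<Omega> i) = faces \<Omega> i" by auto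
qed

definition face_sign :: "int \<Rightarrow> int set \<Rightarrow> ratfun" where
  "face_sign j F = (- 1) ^ (card {l \<in> F. l \<le> j} + 1)"

text \<open>The coefficient of \<open>[G]\<close> in the weighted boundary of \<open>[F]\<close>, for \<open>F \<in> \<Omega>\<^sub>i\<close>.\<close>

definition boundary_coeff :: "int set set \<Rightarrow> int \<Rightarrow> int set \<Rightarrow> int set \<Rightarrow> ratfun" where
  "boundary_coeff \<Omega> i G F = (\<Sum>j\<in>F.
     if F - {j} = G
     then face_sign j F *
       ((raise ^^ nat (complex_dim \<Omega> - i)) (xwt (mset_set F)) /
        (raise ^^ nat (complex_dim \<Omega> - i + 1)) (xwt (mset_set (F - {j}))))
     else 0)"

definition boundary :: "int set set \<Rightarrow> int \<Rightarrow> ratfun mat" where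
  "boundary \<Omega> i = mat (length (face_list \<Omega> (i - 1))) (length (face_list \<Omega> i))
     (\<lambda>(r, c). boundary_coeff \<Omega> i (face_list \<Omega> (i - 1) ! r) (face_list \<Omega> i ! c))"

definition Lud :: "int set set \<Rightarrow> int \<Rightarrow> ratfun mat" where
  "Lud \<Omega> i = boundary \<Omega> (i + 1) * transpose_mat (boundary \<Omega> (i + 1))"

text \<open>Eigenvalues in the algebraic closure, counted with algebraic multiplicity.\<close>

definition Sud :: "int set set \<Rightarrow> int \<Rightarrow> ratfun alg_closure multiset" where
  "Sud \<Omega> i = proots (char_poly (map_mat to_ac (Lud \<Omega> i)))"

definition eq_mod_zeros :: "'a :: zero multiset \<Rightarrow> 'a multiset \<Rightarrow> bool" where
  "eq_mod_zeros M N \<longleftrightarrow> (\<forall>c. c \<noteq> 0 \<longrightarrow> count M c = count N c)"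


section \<open>Critical pairs and signatures\<close>

text \<open>
  \<open>B\<close> arises from \<open>A\<close> by increasing the single element \<open>a\<close> by one. As \<open>B\<close> must have as many elements
  as \<open>A\<close>, this requires \<open>a + 1 \<notin> A\<close>.
\<close>

definition increments :: "int set \<Rightarrow> int set \<Rightarrow> int \<Rightarrow> bool" where
  "increments A B a \<longleftrightarrow> a \<in> A \<and> a + 1 \<notin> A \<and> B = insert (a + 1) (A - {a})"

definition critical_pairs :: "int set set \<Rightarrow> (int set \<times> int set) set" where
  "critical_pairs \<F> = {(A, B). A \<in> \<F> \<and> B \<notin> \<F> \<and> (\<exists>a. increments A B a)}"

lemma increments_unique: "increments A B a \<Longrightarrow> increments A B b \<Longrightarrow> a = b"
  by (auto simp: increments_def)

definition min_vertex :: "int set set \<Rightarrow> int" where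
  "min_vertex \<F> = Min (\<Union>\<F>)"

definition long_sig :: "int set set \<Rightarrow> int set \<times> int set \<Rightarrow> int set \<times> int set" where
  "long_sig \<F> = (\<lambda>(A, B).
     let a = (THE a. increments A B a) in ({b \<in> A. b < a}, {min_vertex \<F>..a}))"

definition LSG :: "int set set \<Rightarrow> (int set \<times> int set) multiset" where
  "LSG \<F> = image_mset (long_sig \<F>) (mset_set (critical_pairs \<F>))"

text \<open>
  \<^const>\<open>mset_set\<close> is only meaningful on finite sets; a finite family of finite sets has
  finitely many critical pairs.
\<close>

lemma finite_critical_pairs:
  assumes "finite \<F>" "\<And>A. A \<in> \<F> \<Longrightarrow> finite A"
  shows "finite (critical_pairs \<F>)"
proof (rule finite_subset)
  show "critical_pairs \<F> \<subseteq> (\<lambda>(A, a). (A, insert (a + 1) (A - {a}))) ` (SIGMA A:\<F>. A)"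
    by (force simp: critical_pairs_def increments_def)
  show "finite ((\<lambda>(A, a). (A, insert (a + 1) (A - {a}))) ` (SIGMA A:\<F>. A))"
    using assms by auto
qed

end

theory Submission
  imports Defs
begin

text \<open>
  Only the faces \<open>K = \<Sigma>\<^sub>i\<close> matter for the nonzero eigenvalues, and \<open>K\<close> splits at its smallest vertex
  \<open>p\<close> into the deletion \<open>\<Delta>\<close> and the link \<open>\<Lambda>\<close>, both shifted on a smaller interval. Because \<open>K\<close> is shifted,
  the boundary of a face of \<open>\<Delta>\<close> is supported on \<open>\<Lambda>\<close>, and the columns \<open>\<partial>(p \<union> H)\<close> with \<open>H \<in> \<Lambda>\<close> span the
  image of \<open>\<partial>\<close>. Writing the Laplacian as a product through the space with basis \<open>\<Lambda>\<close> and exchanging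
  the factors (Sylvester's determinant identity), its nonzero spectrum becomes that of
  \<open>a\<^sup>2 + U + b\<^sup>2V\<close> on this space, where \<open>a = x\<^bsub>1,p\<^esub>\<close>, \<open>b = x\<^bsub>1,p\<^esub> / x\<^bsub>2,p\<^esub>\<close>, \<open>U = \<partial>\<partial>\<^sup>*\<close> comes from \<open>\<Delta>\<close> and
  \<open>V = \<partial>\<^sup>*\<partial>\<close> from the raised weights on \<open>\<Lambda>\<close>. As \<open>UV = 0\<close>, the characteristic polynomial of \<open>U + b\<^sup>2V\<close> is
  the product of those of \<open>U\<close> and \<open>b\<^sup>2V\<close> up to powers of the variable, and both are known by induction.
  The \<open>z\<close>-polynomials satisfy the same recursion, and the critical pairs that increase \<open>p\<close> itself
  account for the eigenvalue \<open>a\<^sup>2\<close>; their number is right because \<open>K\<close> has exactly as many critical pairs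
  as \<open>\<Lambda>\<close> has members.
\<close>

section \<open>Characteristic determinants\<close>

definition enum :: "'a set \<Rightarrow> 'a list" where
  "enum A = (SOME xs. distinct xs \<and> set xs = A)"

lemma enum:
  assumes "finite A"
  shows "distinct (enum A)" "set (enum A) = A" "length (enum A) = card A"
proof -
  have "distinct (enum A) \<and> set (enum A) = A"
    unfolding enum_def by (rule someI_ex) (use finite_distinct_list[OF assms] in blast)
  then show "distinct (enum A)" "set (enum A) = A" "length (enum A) = card A"
    using distinct_card[of "enum A"] by auto
qed

lemma enum_nth_in: "finite A \<Longrightarrow> r < card A \<Longrightarrow> enum A ! r \<in> A"
  by (metis enum(2,3) nth_mem)

lemma enum_nth_eq_iff: "finite A \<Longrightarrow> r < card A \<Longrightarrow> s < card A \<Longrightarrow> enum A ! r = enum A ! s \<longleftrightarrow> r = s"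
  by (simp add: enum nth_eq_iff_index_eq)

lemma sum_enum: "finite A \<Longrightarrow> (\<Sum>k<card A. f (enum A ! k)) = (\<Sum>a\<in>A. f a)"
proof -
  assume A: "finite A"
  have "bij_betw (\<lambda>k. enum A ! k) {..<card A} A"
    using bij_betw_nth[of "enum A" "{..<card A}" A] enum[OF A] by simp
  then show ?thesis by (rule sum.reindex_bij_betw)
qed

definition fun_mat :: "'a set \<Rightarrow> 'b set \<Rightarrow> ('a \<Rightarrow> 'b \<Rightarrow> 'c) \<Rightarrow> 'c mat" where
  "fun_mat A B f = mat (card A) (card B) (\<lambda>(r, c). f (enum A ! r) (enum B ! c))"

lemma fun_mat_carrier [simp]: "fun_mat A B f \<in> carrier_mat (card A) (card B)"
  and dim_fun_mat [simp]: "dim_row (fun_mat A B f) = card A" "dim_col (fun_mat A B f) = card B"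
  and index_fun_mat [simp]: "r < card A \<Longrightarrow> c < card B \<Longrightarrow>
    fun_mat A B f $$ (r, c) = f (enum A ! r) (enum B ! c)"
  by (simp_all add: fun_mat_def)

lemma fun_mat_mult:
  fixes f :: "'a \<Rightarrow> 'b \<Rightarrow> 'k::comm_ring_1"
  assumes "finite B"
  shows "fun_mat A B f * fun_mat B C g = fun_mat A C (\<lambda>a c. \<Sum>b\<in>B. f a b * g b c)"
  by (rule eq_matI) (auto simp: scalar_prod_def sum_enum[OF assms, symmetric] atLeast0LessThan)

lemma fun_mat_cong:
  assumes "finite A" "finite B" "\<And>a b. a \<in> A \<Longrightarrow> b \<in> B \<Longrightarrow> f a b = g a b"
  shows "fun_mat A B f = fun_mat A B g"
  by (rule eq_matI) (auto simp: enum_nth_in assms)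

text \<open>The block matrix with rows \<open>(x, A)\<close> and \<open>(B, 1)\<close> is evaluated
  twice: multiplying it by \<open>?L\<close>, of determinant 1, clears the lower left block, and
  multiplying it by \<open>?R\<close>, of determinant \<open>x ^ m\<close>, clears the upper right
  one.\<close>

lemma det_Sylvester:
  fixes A B :: "'a::idom mat"
  assumes A: "A \<in> carrier_mat n m" and B: "B \<in> carrier_mat m n"
  shows "det (x \<cdot>\<^sub>m 1\<^sub>m n - A * B) * x ^ m = x ^ n * det (x \<cdot>\<^sub>m 1\<^sub>m m - B * A)"
proof -
  let ?N = "four_block_mat (x \<cdot>\<^sub>m 1\<^sub>m n) A B (1\<^sub>m m)"
  let ?L = "four_block_mat (1\<^sub>m n) (0\<^sub>m n m) (- B) (1\<^sub>m m)"
  let ?R = "four_block_mat (1\<^sub>m n) (- A) (0\<^sub>m m n) (x \<cdot>\<^sub>m 1\<^sub>m m)"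
  have c: "x \<cdot>\<^sub>m 1\<^sub>m n \<in> carrier_mat n n" "x \<cdot>\<^sub>m 1\<^sub>m m \<in> carrier_mat m m"
    "1\<^sub>m n \<in> carrier_mat n n" "1\<^sub>m m \<in> carrier_mat m m" "- A \<in> carrier_mat n m" "- B \<in> carrier_mat m n"
    "A * B \<in> carrier_mat n n" "B * A \<in> carrier_mat m m"
    using A B by auto
  have blk: "four_block_mat P Q R S = four_block_mat P' Q' R' S'"
    if "P = P'" "Q = Q'" "R = R'" "S = S'" for P Q R S P' Q' R' S' :: "'a mat"
    using that by simp
  have N: "?N \<in> carrier_mat (n + m) (n + m)"
    and L: "?L \<in> carrier_mat (n + m) (n + m)" and R: "?R \<in> carrier_mat (n + m) (n + m)"
    using A B by auto
  have "?N * ?L = four_block_mat (x \<cdot>\<^sub>m 1\<^sub>m n - A * B) A (0\<^sub>m m n) (1\<^sub>m m)"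
    unfolding mult_four_block_mat[OF c(1) A B c(4) c(3) zero_carrier_mat c(6) c(4)]
    by (rule blk) (use A B in \<open>auto intro!: eq_matI\<close>)
  then have "det (?N * ?L) = det (x \<cdot>\<^sub>m 1\<^sub>m n - A * B)"
    by (simp add: det_four_block_mat_lower_left_zero[OF minus_carrier_mat[OF c(7)] A refl c(4)])
  moreover have "det ?L = 1"
    using B by (subst det_four_block_mat_upper_right_zero[of _ n _ m]) auto
  ultimately have 1: "det ?N = det (x \<cdot>\<^sub>m 1\<^sub>m n - A * B)"
    by (simp add: det_mult[OF N L])
  have "?N * ?R = four_block_mat (x \<cdot>\<^sub>m 1\<^sub>m n) (0\<^sub>m n m) B (x \<cdot>\<^sub>m 1\<^sub>m m - B * A)"
    unfolding mult_four_block_mat[OF c(1) A B c(4) c(3) c(5) zero_carrier_mat c(2)]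
    by (rule blk) (use A B in \<open>auto intro!: eq_matI\<close>)
  then have "det (?N * ?R) = x ^ n * det (x \<cdot>\<^sub>m 1\<^sub>m m - B * A)"
    by (simp add: det_four_block_mat_upper_right_zero[OF c(1) refl B minus_carrier_mat[OF c(8)]])
  moreover have "det ?R = x ^ m"
    using A by (subst det_four_block_mat_lower_left_zero[of _ n _ m]) auto
  ultimately show ?thesis
    by (simp add: det_mult[OF N R] 1)
qed

text \<open>\<open>x\<close> is any polynomial and not just the variable, because the recursion
  replaces the variable by translates.\<close>

definition char_det :: "'k poly \<Rightarrow> 'a set \<Rightarrow> ('a \<Rightarrow> 'a \<Rightarrow> 'k) \<Rightarrow> 'k::field poly" where
  "char_det x A f = det (fun_mat A A (\<lambda>a b. (if a = b then x else 0) - [:f a b:]))"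

lemma char_det_alt:
  assumes "finite A"
  shows "char_det x A f = det (x \<cdot>\<^sub>m 1\<^sub>m (card A) - fun_mat A A (\<lambda>a b. [:f a b:]))"
  unfolding char_det_def
  by (rule arg_cong[where f = det], rule eq_matI) (auto simp: enum_nth_eq_iff assms)

lemma char_poly_fun_mat:
  assumes "finite A"
  shows "char_poly (fun_mat A A f) = char_det [:0, 1:] A f"
  unfolding char_det_alt[OF assms] char_poly_defs
  by (rule arg_cong[where f = det], rule eq_matI) auto

lemma char_det_cong:
  assumes "finite A" "\<And>a b. a \<in> A \<Longrightarrow> b \<in> A \<Longrightarrow> f a b = g a b"
  shows "char_det x A f = char_det x A g"
  unfolding char_det_def using assms by (auto intro!: arg_cong[where f = det] fun_mat_cong)

lemma char_det_shift:
  assumes "finite A" "\<And>a b. a \<in> A \<Longrightarrow> b \<in> A \<Longrightarrow> f a b = (if a = b then c else 0) + g a b"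
  shows "char_det x A f = char_det (x - [:c:]) A g"
  unfolding char_det_def using assms by (auto intro!: arg_cong[where f = det] fun_mat_cong)

lemma sum_const_poly: "(\<Sum>b\<in>B. [:f b:]) = [:\<Sum>b\<in>B. f b:]"
  by (induction B rule: infinite_finite_induct) auto

lemma char_det_Sylvester:
  fixes f :: "'a \<Rightarrow> 'b \<Rightarrow> 'k::field"
  assumes "finite A" "finite B"
  shows "char_det x A (\<lambda>a a'. \<Sum>b\<in>B. f a b * g b a') * x ^ card B =
    x ^ card A * char_det x B (\<lambda>b b'. \<Sum>a\<in>A. g b a * f a b')"
  using det_Sylvester[OF fun_mat_carrier fun_mat_carrier,
      of x A B "\<lambda>a b. [:f a b:]" "\<lambda>b a. [:g b a:]"]
  by (simp add: char_det_alt assms fun_mat_mult sum_const_poly mult.commute)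

lemma char_det_zero:
  fixes f :: "'a \<Rightarrow> 'a \<Rightarrow> 'k::field"
  assumes "finite A" "\<And>a b. a \<in> A \<Longrightarrow> b \<in> A \<Longrightarrow> f a b = 0"
  shows "char_det x A f = x ^ card A"
proof -
  have "char_det x {} h = 1" for h :: "nat \<Rightarrow> nat \<Rightarrow> 'k"
    unfolding char_det_def by (rule det_dim_zero) (use fun_mat_carrier[of "{}::nat set" "{}::nat set"] in simp)
  \<comment> \<open>The zero matrix is a product through an empty index set, so Sylvester's identity
    reduces it to a determinant of size 0.\<close>
  moreover have "char_det x A f = char_det x A (\<lambda>a a'. \<Sum>b\<in>({}::nat set). 0 * 0)"
    using assms by (intro char_det_cong) auto
  ultimately show ?thesis
    using char_det_Sylvester[of A "{}::nat set" x "\<lambda>_ _. 0" "\<lambda>_ _. 0"] assms(1) by simp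
qed

text \<open>As \<open>f g = 0\<close>, \<open>(x - f)(x - g) = x (x - f - g)\<close>; in the
  determinant the scalar \<open>x\<close> becomes \<open>x ^ card A\<close>.\<close>

lemma char_det_add:
  fixes f :: "'a \<Rightarrow> 'a \<Rightarrow> 'k::field"
  assumes A: "finite A" and 0: "\<And>a c. a \<in> A \<Longrightarrow> c \<in> A \<Longrightarrow> (\<Sum>b\<in>A. f a b * g b c) = 0"
  shows "char_det x A (\<lambda>a b. f a b + g a b) * x ^ card A = char_det x A f * char_det x A g"
proof -
  have eq: "fun_mat A A (\<lambda>a b. (if a = b then x else 0) - [:f a b:]) *
      fun_mat A A (\<lambda>a b. (if a = b then x else 0) - [:g a b:]) =
    x \<cdot>\<^sub>m fun_mat A A (\<lambda>a b. (if a = b then x else 0) - [:f a b + g a b:])" (is "_ * _ = ?R")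
  proof -
    have "(\<Sum>b\<in>A. ((if a = b then x else 0) - [:f a b:]) * ((if b = c then x else 0) - [:g b c:]))
        = x * ((if a = c then x else 0) - [:f a c + g a c:])" if "a \<in> A" "c \<in> A" for a c
    proof -
      have "(\<Sum>b\<in>A. ((if a = b then x else 0) - [:f a b:]) * ((if b = c then x else 0) - [:g b c:])) =
        (\<Sum>b\<in>A. (if a = b then x * ((if b = c then x else 0) - [:g b c:]) else 0)
          - (if b = c then x * [:f a b:] else 0) + [:f a b:] * [:g b c:])"
        by (rule sum.cong) (auto simp: algebra_simps)
      also have "\<dots> = x * ((if a = c then x else 0) - [:g a c:]) - x * [:f a c:]"
        using A that 0 by (simp add: sum.distrib sum_subtractf sum_const_poly mult.commute)
      also have "\<dots> = x * ((if a = c then x else 0) - ([:f a c:] + [:g a c:]))"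
        by (simp add: right_diff_distrib distrib_left del: add_pCons)
      finally show ?thesis by simp
    qed
    then show ?thesis
      unfolding fun_mat_mult[OF A]
      by (intro eq_matI) (auto simp: enum_nth_in A simp del: mult_pCons_left mult_pCons_right)
  qed
  show ?thesis
    unfolding char_det_def
    by (subst det_mult[symmetric, OF fun_mat_carrier fun_mat_carrier])
      (simp add: eq mult.commute)
qed


section \<open>Weighted boundaries\<close>

text \<open>Raising is modelled as a shift of the position index, so that the linear algebra can be
  done over any field.\<close>

abbreviation up :: "(nat \<Rightarrow> int \<Rightarrow> 'k) \<Rightarrow> nat \<Rightarrow> int \<Rightarrow> 'k" where
  "up w \<equiv> \<lambda>a. w (Suc a)"

text \<open>\<open>w k j\<close> is the weight of \<open>j\<close> in position \<open>k\<close>, with positions starting at 0.\<close>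

fun list_weight :: "(nat \<Rightarrow> int \<Rightarrow> 'k::field) \<Rightarrow> int list \<Rightarrow> 'k" where
  "list_weight w [] = 1"
| "list_weight w (j # js) = w 0 j * list_weight (up w) js"

definition weight :: "(nat \<Rightarrow> int \<Rightarrow> 'k::field) \<Rightarrow> int multiset \<Rightarrow> 'k" where
  "weight w M = list_weight w (sorted_list_of_multiset M)"

text \<open>The least element takes position 0 and pushes the others one position further; this is
  where the recursion passes from \<open>w\<close> to \<open>up w\<close>.\<close>

lemma weight_add_min:
  assumes "\<And>j. j \<in># M \<Longrightarrow> p \<le> j"
  shows "weight w (add_mset p M) = w 0 p * weight (up w) M"
  using assms by (simp add: weight_def insort_is_Cons)

lemma list_weight_nonzero: "\<forall>a j. w a j \<noteq> 0 \<Longrightarrow> list_weight w js \<noteq> 0"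
  by (induction js arbitrary: w) auto

lemma weight_nonzero: "\<forall>a j. w a j \<noteq> 0 \<Longrightarrow> weight w M \<noteq> 0"
  by (simp add: weight_def list_weight_nonzero)

definition bsign :: "int \<Rightarrow> int set \<Rightarrow> 'k::field" where
  "bsign j F = (- 1) ^ (card {l \<in> F. l \<le> j} + 1)"

text \<open>\<open>w\<close> already includes the raising by the codimension, so an entry depends on
  the two faces only and on no ambient complex.\<close>

definition bdry :: "(nat \<Rightarrow> int \<Rightarrow> 'k::field) \<Rightarrow> int set \<Rightarrow> int set \<Rightarrow> 'k" where
  "bdry w G F = (\<Sum>j\<in>F. if F - {j} = G
     then bsign j F * (weight w (mset_set F) / weight (up w) (mset_set (F - {j}))) else 0)"

lemma bdry_eq_0: "(\<And>j. j \<in> F \<Longrightarrow> F - {j} \<noteq> G) \<Longrightarrow> bdry w G F = 0"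
  by (auto simp: bdry_def intro!: sum.neutral)

lemma bsign_insert_min:
  assumes "finite H" "\<And>l. l \<in> H \<Longrightarrow> p < l"
  shows "bsign p (insert p H) = 1" "j \<in> H \<Longrightarrow> bsign j (insert p H) = - bsign j H"
proof -
  have "{l \<in> insert p H. l \<le> p} = {p}"
    using assms by force
  then show "bsign p (insert p H) = 1" by (simp add: bsign_def)
  assume j: "j \<in> H"
  then have "{l \<in> insert p H. l \<le> j} = insert p {l \<in> H. l \<le> j}"
    using assms(2)[OF j] by auto
  moreover have "p \<notin> H" using assms(2) by blast
  ultimately show "bsign j (insert p H) = - bsign j H"
    using assms(1) by (simp add: bsign_def)
qed

text \<open>Dropping \<open>p\<close> leaves \<open>H\<close> with sign \<open>+1\<close> and the
  weight of \<open>p\<close>. Dropping \<open>j\<close> from \<open>H\<close> keeps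
  \<open>p\<close>, which flips the sign of \<open>j\<close> and contributes \<open>w 0 p\<close> to
  the numerator and \<open>w 1 p\<close> to the denominator.\<close>

lemma bdry_insert_min:
  assumes H: "finite H" "\<And>l. l \<in> H \<Longrightarrow> p < l" and w: "\<forall>a j. w a j \<noteq> 0"
  shows "bdry w G (insert p H) = (if G = H then w 0 p else 0)
    - (if p \<in> G then w 0 p / w 1 p * bdry (up w) (G - {p}) H else 0)"
proof -
  have p: "p \<notin> H" using H(2) by blast
  have wt: "weight w (mset_set (insert p H)) = w 0 p * weight (up w) (mset_set H)"
    using H p by (subst mset_set.insert) (auto intro!: weight_add_min less_imp_le)
  have "bdry w G (insert p H) = (if H = G then w 0 p else 0) +
    (\<Sum>j\<in>H. if insert p H - {j} = G
     then bsign j (insert p H) * (weight w (mset_set (insert p H)) / weight (up w) (mset_set (insert p H - {j}))) else 0)"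
  proof -
    have Hp: "insert p H - {p} = H" using p by simp
    have "bsign p (insert p H) * (weight w (mset_set (insert p H)) / weight (up w) (mset_set (insert p H - {p}))) = w 0 p"
      using w by (simp add: Hp bsign_insert_min[OF H] wt weight_nonzero)
    then show ?thesis
      unfolding bdry_def sum.insert[OF H(1) p] by (simp only: Hp)
  qed
  also have "(\<Sum>j\<in>H. if insert p H - {j} = G
     then bsign j (insert p H) * (weight w (mset_set (insert p H)) / weight (up w) (mset_set (insert p H - {j}))) else 0)
    = (\<Sum>j\<in>H. if p \<in> G \<and> H - {j} = G - {p} then - (w 0 p / w 1 p *
        (bsign j H * (weight (up w) (mset_set H) / weight (up (up w)) (mset_set (H - {j}))))) else 0)"
  proof (rule sum.cong[OF refl])
    fix j assume j: "j \<in> H"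
    then have ins: "insert p H - {j} = insert p (H - {j})" and pj: "p \<notin> H - {j}"
      using p by auto
    then have iff: "insert p H - {j} = G \<longleftrightarrow> p \<in> G \<and> H - {j} = G - {p}"
      by auto
    have "weight (up w) (mset_set (insert p H - {j})) = w 1 p * weight (up (up w)) (mset_set (H - {j}))"
      using H pj unfolding ins
      by (subst mset_set.insert) (auto simp: less_imp_le intro!: weight_add_min[THEN trans])
    then show "(if insert p H - {j} = G
     then bsign j (insert p H) * (weight w (mset_set (insert p H)) / weight (up w) (mset_set (insert p H - {j}))) else 0)
     = (if p \<in> G \<and> H - {j} = G - {p} then - (w 0 p / w 1 p *
        (bsign j H * (weight (up w) (mset_set H) / weight (up (up w)) (mset_set (H - {j}))))) else 0)"
      unfolding iff by (simp add: bsign_insert_min(2)[OF H j] wt)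
  qed
  also have "\<dots> = - (if p \<in> G then w 0 p / w 1 p * bdry (up w) (G - {p}) H else 0)"
    by (auto simp: bdry_def sum_distrib_left sum_negf[symmetric] intro!: sum.cong)
  finally show ?thesis by auto
qed

lemma sum_bdry:
  assumes "finite A" "finite F" "\<forall>j\<in>F. F - {j} \<in> A"
  shows "(\<Sum>H\<in>A. c H * bdry w H F) = (\<Sum>j\<in>F. c (F - {j}) *
    (bsign j F * (weight w (mset_set F) / weight (up w) (mset_set (F - {j})))))"
proof -
  have "(\<Sum>H\<in>A. c H * bdry w H F) = (\<Sum>j\<in>F. \<Sum>H\<in>A. if F - {j} = H then c (F - {j}) *
    (bsign j F * (weight w (mset_set F) / weight (up w) (mset_set (F - {j})))) else 0)"
    unfolding bdry_def sum_distrib_left by (subst sum.swap) (auto intro!: sum.cong)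
  also have "\<dots> = (\<Sum>j\<in>F. c (F - {j}) *
    (bsign j F * (weight w (mset_set F) / weight (up w) (mset_set (F - {j})))))"
    using assms by (intro sum.cong) auto
  finally show ?thesis .
qed

lemma bsign_Diff:
  assumes "finite F" "i \<in> F" "j \<in> F" "i < j"
  shows "bsign i (F - {j}) = (bsign i F :: 'k::field)" "bsign j (F - {i}) = - (bsign j F :: 'k)"
proof -
  have "{l \<in> F - {j}. l \<le> i} = {l \<in> F. l \<le> i}" using assms by auto
  then show "bsign i (F - {j}) = (bsign i F :: 'k)" by (simp add: bsign_def)
  have "{l \<in> F. l \<le> j} = insert i {l \<in> F - {i}. l \<le> j}" using assms by auto
  then have "card {l \<in> F. l \<le> j} = Suc (card {l \<in> F - {i}. l \<le> j})" using assms by simp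
  then show "bsign j (F - {i}) = - (bsign j F :: 'k)" by (simp add: bsign_def)
qed

text \<open>The weights telescope in \<open>\<partial>\<^sup>2\<close>, so its terms cancel as in the unweighted case.\<close>

lemma bdry_bdry:
  fixes w :: "nat \<Rightarrow> int \<Rightarrow> 'k::field"
  assumes A: "finite A" "finite F" "\<forall>j\<in>F. F - {j} \<in> A" and w: "\<forall>a j. w a j \<noteq> 0"
  shows "(\<Sum>H\<in>A. bdry (up w) G H * bdry w H F) = 0"
proof -
  \<comment> \<open>\<open>g j i\<close> is the contribution to row \<open>G\<close> of dropping
    first \<open>j\<close> and then \<open>i\<close>.\<close>
  define g where "g j i = (if F - {j} - {i} = G then bsign i (F - {j}) * bsign j F *
    (weight w (mset_set F) / weight (up (up w)) (mset_set G)) else 0)" for i j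
  have anti: "g j i = - g i j" if "i \<in> F" "j \<in> F" "i < j" for i j
    using bsign_Diff[OF A(2) that, where 'k = 'k] by (auto simp: g_def Diff_insert2[symmetric] insert_commute)
  have telescope: "a * (y / z) * (b * (x / y)) = a * b * (x / z)" if "y \<noteq> 0" for a b x y z :: 'k
    using that by simp
  have nz: "weight (up w) M \<noteq> 0" for M
    using w by (simp add: weight_nonzero)
  have "(\<Sum>H\<in>A. bdry (up w) G H * bdry w H F) = (\<Sum>j\<in>F. \<Sum>i\<in>F - {j}. g j i)"
    unfolding sum_bdry[OF A] unfolding bdry_def sum_distrib_right g_def
    by (intro sum.cong refl) (simp only: telescope[OF nz] mult_zero_left split: if_split, blast)
  also have "\<dots> = (\<Sum>(j, i)\<in>(SIGMA j:F. F - {j}). g j i)"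
    using A(2) by (simp add: sum.Sigma)
  \<comment> \<open>The ordered pairs of distinct vertices are those with \<open>i < j\<close> and
    their mirror images, where \<open>g\<close> takes the opposite values.\<close>
  also have "(SIGMA j:F. F - {j}) = {(j, i)\<in>F \<times> F. i < j} \<union> prod.swap ` {(j, i)\<in>F \<times> F. i < j}"
    by (auto simp: image_iff)
  also have "(\<Sum>(j, i)\<in>\<dots>. g j i) = (\<Sum>(j, i)\<in>{(j, i)\<in>F \<times> F. i < j}. g j i) +
    (\<Sum>(j, i)\<in>prod.swap ` {(j, i)\<in>F \<times> F. i < j}. g j i)"
  proof -
    have "finite {(j, i)\<in>F \<times> F. i < j}"
      by (rule finite_subset[of _ "F \<times> F"]) (auto simp: A(2))
    moreover have "{(j, i)\<in>F \<times> F. i < j} \<inter> prod.swap ` {(j, i)\<in>F \<times> F. i < j} = {}"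
      by auto
    ultimately show ?thesis by (intro sum.union_disjoint) simp_all
  qed
  also have "(\<Sum>(j, i)\<in>prod.swap ` {(j, i)\<in>F \<times> F. i < j}. g j i) =
    (\<Sum>p\<in>{(j, i)\<in>F \<times> F. i < j}. case prod.swap p of (j, i) \<Rightarrow> g j i)"
    by (rule sum.reindex[unfolded o_def]) simp
  also have "\<dots> = (\<Sum>p\<in>{(j, i)\<in>F \<times> F. i < j}. - (case p of (j, i) \<Rightarrow> g j i))"
    by (rule sum.cong) (auto simp: anti)
  finally show ?thesis
    by (simp only: sum_negf add.right_inverse)
qed

section \<open>The z-polynomials and their recursion at the least vertex\<close>

text \<open>\<open>zval w p A a\<close> is \<open>z(S, T)\<close> for the long signature \<open>(S, T)\<close> of the critical pair that
  increases \<open>a \<in> A\<close>.\<close>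

definition zval :: "(nat \<Rightarrow> int \<Rightarrow> 'k::field) \<Rightarrow> int \<Rightarrow> int set \<Rightarrow> int \<Rightarrow> 'k" where
  "zval w p A a = (\<Sum>j\<in>{p..a}. (weight w (add_mset j (mset_set {b \<in> A. b < a})) /
     weight (up w) (mset_set {b \<in> A. b < a}))\<^sup>2)"

text \<open>Adjoining a lower bound \<open>p\<close> shifts the other positions exactly as
  \<open>up\<close> does, so only the weight of \<open>p\<close> survives in the quotient. This is
  the summand \<open>j = p\<close> of \<open>zval\<close>.\<close>

lemma weight_ratio_min:
  assumes "A \<subseteq> {p..}" "\<forall>a j. w a j \<noteq> 0"
  shows "weight w (add_mset p (mset_set {b \<in> A. b < a})) / weight (up w) (mset_set {b \<in> A. b < a}) = w 0 p"
proof -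
  have "p \<le> j" if "j \<in># mset_set {b \<in> A. b < a}" for j
    using that assms(1) by (cases "finite {b \<in> A. b < a}") auto
  then show ?thesis using assms(2) by (simp add: weight_add_min weight_nonzero)
qed

lemma atLeastAtMost_int_insert: "p \<le> a \<Longrightarrow> {p..a} = insert p {p+1..a::int}"
  by auto

lemma zval_skip:
  assumes "A \<subseteq> {p+1..}" "p \<le> a" "\<forall>a j. w a j \<noteq> 0"
  shows "zval w p A a = (w 0 p)\<^sup>2 + zval w (p + 1) A a"
proof -
  have "A \<subseteq> {p..}" using assms(1) by auto
  from weight_ratio_min[OF this assms(3)] show ?thesis
    using assms(2) by (simp add: zval_def atLeastAtMost_int_insert[of p a])
qed

text \<open>In each summand with \<open>j > p\<close>, \<open>p\<close> is least in numerator and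
  denominator and splits off as \<open>w 0 p / w 1 p\<close>, the same factor that scales the link
  part of the Laplacian.\<close>

lemma zval_insert_min:
  assumes A: "finite A" "A \<subseteq> {p+1..}" and a: "p < a" and w: "\<forall>a j. w a j \<noteq> 0"
  shows "zval w p (insert p A) a = (w 0 p)\<^sup>2 + (w 0 p / w 1 p)\<^sup>2 * zval (up w) (p + 1) A a"
proof -
  let ?S = "{b \<in> A. b < a}"
  have fin: "finite ?S" and p: "p \<notin> ?S" and eq: "{b \<in> insert p A. b < a} = insert p ?S"
    using A a by auto
  have wt: "weight (up w) (mset_set (insert p ?S)) = w 1 p * weight (up (up w)) (mset_set ?S)"
  proof -
    have "p \<le> l" if "l \<in># mset_set ?S" for l
      using that fin A(2) by auto
    then show ?thesis
      using weight_add_min[of "mset_set ?S" p "up w"] mset_set.insert[OF fin p] by simp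
  qed
  have wt': "weight w (add_mset j (mset_set (insert p ?S))) = w 0 p * weight (up w) (add_mset j (mset_set ?S))"
    if "j \<in> {p+1..a}" for j
  proof -
    have "p \<le> l" if "l \<in># add_mset j (mset_set ?S)" for l
      using that \<open>j \<in> {p+1..a}\<close> fin A(2) by auto
    then show ?thesis
      using weight_add_min[of "add_mset j (mset_set ?S)" p w] mset_set.insert[OF fin p]
      by (simp add: add_mset_commute[of j p])
  qed
  have "insert p A \<subseteq> {p..}" using A by auto
  from weight_ratio_min[OF this w, of a] have
    "zval w p (insert p A) a = (w 0 p)\<^sup>2 + (\<Sum>j\<in>{p+1..a}. (weight w (add_mset j (mset_set (insert p ?S))) /
     weight (up w) (mset_set (insert p ?S)))\<^sup>2)"
    using a unfolding zval_def eq by (simp add: atLeastAtMost_int_insert[of p a])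
  also have "(\<Sum>j\<in>{p+1..a}. (weight w (add_mset j (mset_set (insert p ?S))) /
     weight (up w) (mset_set (insert p ?S)))\<^sup>2) = (w 0 p / w 1 p)\<^sup>2 * zval (up w) (p + 1) A a"
    unfolding zval_def sum_distrib_left
    by (intro sum.cong refl) (simp add: wt wt' power_mult_distrib power_divide)
  finally show ?thesis .
qed

lemma zval_self:
  assumes "A \<subseteq> {p..}" "\<forall>a j. w a j \<noteq> 0"
  shows "zval w p A p = (w 0 p)\<^sup>2"
  using weight_ratio_min[OF assms, of p] by (simp add: zval_def)


section \<open>Shifted families and their critical pairs\<close>

text \<open>The exchange property without closure under subsets: deletion and link of a family of
  faces of one dimension inherit it, although they need not be complexes.\<close>

definition shifted_family :: "int \<Rightarrow> int \<Rightarrow> int set set \<Rightarrow> bool" where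
  "shifted_family p q K \<longleftrightarrow> K \<subseteq> Pow {p..q} \<and>
     (\<forall>A\<in>K. \<forall>i j. p \<le> i \<and> i < j \<and> i \<notin> A \<and> j \<in> A \<longrightarrow> insert i (A - {j}) \<in> K)"

lemma shifted_familyD:
  "shifted_family p q K \<Longrightarrow> A \<in> K \<Longrightarrow> p \<le> i \<Longrightarrow> i < j \<Longrightarrow> i \<notin> A \<Longrightarrow> j \<in> A \<Longrightarrow> insert i (A - {j}) \<in> K"
  by (simp add: shifted_family_def)

lemma shifted_family_ge: "shifted_family p q K \<Longrightarrow> A \<in> K \<Longrightarrow> a \<in> A \<Longrightarrow> p \<le> a"
  unfolding shifted_family_def by (meson PowD atLeastAtMost_iff subsetD)

definition deletion :: "int \<Rightarrow> int set set \<Rightarrow> int set set" where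
  "deletion p K = {A \<in> K. p \<notin> A}"

definition link :: "int \<Rightarrow> int set set \<Rightarrow> int set set" where
  "link p K = {A. p \<notin> A \<and> insert p A \<in> K}"

lemma deletion_un_link: "K = deletion p K \<union> insert p ` link p K"
proof -
  have "A \<in> insert p ` link p K" if "A \<in> K" "p \<in> A" for A
    using that by (intro image_eqI[of _ _ "A - {p}"]) (auto simp: link_def insert_absorb)
  then show ?thesis by (auto simp: deletion_def link_def)
qed

lemma finite_shifted_family: "shifted_family p q K \<Longrightarrow> finite K"
  by (auto simp: shifted_family_def intro: finite_subset)

lemma finite_deletion: "finite K \<Longrightarrow> finite (deletion p K)"
  by (simp add: deletion_def)

lemma inj_on_insert_link: "inj_on (insert p) (link p K)"
  by (auto simp: inj_on_def link_def insert_ident)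

lemma finite_link: "finite K \<Longrightarrow> finite (link p K)"
  by (rule finite_imageD[OF finite_subset inj_on_insert_link[of p K]]) (auto simp: link_def)

lemma shifted_family_deletion:
  assumes "shifted_family p q K"
  shows "shifted_family (p + 1) q (deletion p K)"
proof -
  have "A \<subseteq> {p + 1..q}" if "A \<in> K" "p \<notin> A" for A
  proof
    fix x assume "x \<in> A"
    moreover have "A \<subseteq> {p..q}"
      using that(1) assms by (auto simp: shifted_family_def)
    ultimately show "x \<in> {p + 1..q}"
      using that(2) by (cases "x = p") auto
  qed
  then show ?thesis
    using shifted_familyD[OF assms] by (auto simp: shifted_family_def deletion_def)
qed

lemma shifted_family_link:
  assumes "shifted_family p q K"
  shows "shifted_family (p + 1) q (link p K)"
proof -
  have "A \<subseteq> {p + 1..q}" if "insert p A \<in> K" "p \<notin> A" for A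
  proof
    fix x assume "x \<in> A"
    moreover have "insert p A \<subseteq> {p..q}"
      using that(1) assms by (auto simp: shifted_family_def)
    ultimately show "x \<in> {p + 1..q}"
      using that(2) by (cases "x = p") auto
  qed
  moreover have "insert p (insert i (A - {j})) \<in> K"
    if "p \<notin> A" "insert p A \<in> K" "p + 1 \<le> i" "i < j" "i \<notin> A" "j \<in> A" for A i j
  proof -
    have "insert p (insert i (A - {j})) = insert i (insert p A - {j})"
      using that by auto
    then show ?thesis
      using shifted_familyD[OF assms that(2), of i j] that by simp
  qed
  ultimately show ?thesis
    by (auto simp: shifted_family_def link_def)
qed

text \<open>Exchanging \<open>j\<close> for the smaller \<open>p\<close> turns \<open>A\<close> into
  \<open>insert p (A - {j})\<close>, again in \<open>K\<close>. Hence boundaries of faces of the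
  deletion are supported on the link.\<close>

lemma deletion_diff_in_link:
  assumes "shifted_family p q K" "A \<in> deletion p K" "j \<in> A"
  shows "A - {j} \<in> link p K"
proof -
  have "p < j" using assms by (force simp: deletion_def shifted_family_def order.strict_iff_order)
  then show ?thesis
    using assms shifted_familyD[OF assms(1), of A p j] by (auto simp: deletion_def link_def)
qed

section \<open>Critical pairs and their number\<close>

definition crit :: "int set set \<Rightarrow> (int set \<times> int) set" where
  "crit K = {(A, a). A \<in> K \<and> a \<in> A \<and> a + 1 \<notin> A \<and> insert (a + 1) (A - {a}) \<notin> K}"

lemma finite_crit: "shifted_family p q K \<Longrightarrow> finite (crit K)"
  by (rule finite_subset[of _ "K \<times> {p..q}"])
    (auto simp: crit_def shifted_family_def intro: finite_subset)

text \<open>These \<open>A\<close> index the critical pairs that increase \<open>p\<close> itself in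
  \<open>insert p A\<close>.\<close>

definition apex_crit :: "int \<Rightarrow> int set set \<Rightarrow> int set set" where
  "apex_crit p K = {A \<in> link p K. p + 1 \<notin> A \<and> insert (p + 1) A \<notin> K}"

text \<open>Increasing \<open>a \<ge> p\<close> never creates \<open>p\<close> and destroys it only
  if \<open>a = p\<close>. So for \<open>a \<noteq> p\<close> criticality is decided inside the
  deletion or inside the link.\<close>

lemma crit_decomp:
  assumes K: "shifted_family p q K"
  shows "crit K = crit (deletion p K) \<union> map_prod (insert p) id ` crit (link p K) \<union>
    (\<lambda>A. (insert p A, p)) ` apex_crit p K" (is "_ = ?C0 \<union> ?C1 \<union> ?C2")
proof (rule subset_antisym; rule subsetI)
  have sub: "p \<le> a" if "A \<in> K" "a \<in> A" for A a
    using shifted_family_ge[OF K] that by blast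
  fix x assume "x \<in> crit K"
  then obtain A a where x: "x = (A, a)" and A: "A \<in> K" "a \<in> A" "a + 1 \<notin> A" "insert (a + 1) (A - {a}) \<notin> K"
    by (auto simp: crit_def)
  have pa: "p \<le> a" by (rule sub[OF A(1,2)])
  consider "p \<notin> A" | "p \<in> A" "a \<noteq> p" | "p \<in> A" "a = p" by blast
  then show "x \<in> ?C0 \<union> ?C1 \<union> ?C2"
  proof cases
    case 1
    then show ?thesis using x A by (auto simp: crit_def deletion_def)
  next
    case 2
    have "insert p (insert (a + 1) (A - {p} - {a})) = insert (a + 1) (A - {a})"
      using 2 by auto
    then have "(A - {p}, a) \<in> crit (link p K)"
      using 2 A pa by (auto simp: crit_def link_def insert_absorb)
    moreover have "x = map_prod (insert p) id (A - {p}, a)"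
      using 2 x by (auto simp: insert_absorb)
    ultimately show ?thesis by blast
  next
    case 3
    then have "A - {p} \<in> apex_crit p K"
      using A by (auto simp: apex_crit_def link_def insert_absorb)
    moreover have "x = (\<lambda>A. (insert p A, p)) (A - {p})"
      using 3 x by (auto simp: insert_absorb)
    ultimately show ?thesis by blast
  qed
next
  have sub: "p \<le> a" if "A \<in> K" "a \<in> A" for A a
    using shifted_family_ge[OF K] that by blast
  fix x assume "x \<in> ?C0 \<union> ?C1 \<union> ?C2"
  then consider A a where "x = (A, a)" "(A, a) \<in> crit (deletion p K)"
    | A a where "x = (insert p A, a)" "(A, a) \<in> crit (link p K)"
    | A where "x = (insert p A, p)" "A \<in> apex_crit p K" by (cases x) auto
  then show "x \<in> crit K"
  proof cases
    case 1
    then have "p \<le> a" using sub by (auto simp: crit_def deletion_def)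
    then show ?thesis using 1 by (auto simp: crit_def deletion_def)
  next
    case 2
    then have "p \<le> a" "a \<noteq> p" using sub by (auto simp: crit_def link_def)
    moreover have "insert p (insert (a + 1) (A - {a})) = insert (a + 1) (insert p A - {a})"
      using \<open>a \<noteq> p\<close> by auto
    ultimately show ?thesis using 2 by (auto simp: crit_def link_def)
  next
    case 3
    then have "insert (p + 1) (insert p A - {p}) = insert (p + 1) A"
      by (auto simp: apex_crit_def link_def)
    then show ?thesis using 3 by (auto simp: crit_def apex_crit_def link_def)
  qed
qed

lemma inj_on_insert_crit_link: "inj_on (map_prod (insert p) id) (crit (link p K))"
  by (rule inj_onI) (auto simp: crit_def link_def insert_ident)

lemma inj_on_apex_crit: "inj_on (\<lambda>A. (insert p A, p)) (apex_crit p K)"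
  by (rule inj_onI) (auto simp: apex_crit_def link_def insert_ident)

lemma prod_crit:
  fixes g :: "int set \<times> int \<Rightarrow> 'c::comm_monoid_mult"
  assumes K: "shifted_family p q K"
  shows "prod g (crit K) = prod g (crit (deletion p K)) *
    (\<Prod>(A, a)\<in>crit (link p K). g (insert p A, a)) * (\<Prod>A\<in>apex_crit p K. g (insert p A, p))"
proof -
  have fin: "finite (crit (deletion p K))" "finite (crit (link p K))"
    using finite_crit shifted_family_deletion[OF K] shifted_family_link[OF K] by blast+
  have fin2: "finite (apex_crit p K)"
    using finite_link[OF finite_shifted_family[OF K], of p] by (simp add: apex_crit_def)
  have d: "crit (deletion p K) \<inter> map_prod (insert p) id ` crit (link p K) = {}"
    "(crit (deletion p K) \<union> map_prod (insert p) id ` crit (link p K)) \<inter> (\<lambda>A. (insert p A, p)) ` apex_crit p K = {}"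
    by (auto simp: crit_def deletion_def link_def apex_crit_def)
  have "prod g (map_prod (insert p) id ` crit (link p K)) = (\<Prod>(A, a)\<in>crit (link p K). g (insert p A, a))"
    by (subst prod.reindex[OF inj_on_insert_crit_link]) (auto intro!: prod.cong)
  moreover have "prod g ((\<lambda>A. (insert p A, p)) ` apex_crit p K) = (\<Prod>A\<in>apex_crit p K. g (insert p A, p))"
    by (subst prod.reindex[OF inj_on_apex_crit]) simp
  ultimately show ?thesis
    unfolding crit_decomp[OF K] using fin fin2 by (simp only: prod.union_disjoint d finite_UnI finite_imageI)
qed

lemma card_crit_decomp:
  assumes K: "shifted_family p q K"
  shows "card (crit K) = card (crit (deletion p K)) + card (crit (link p K)) + card (apex_crit p K)"
proof -
  \<comment> \<open>For the constant 2 the product formula equates powers of 2, whose exponents are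
    the wanted cardinalities.\<close>
  have "(2::nat) ^ card (crit K) = 2 ^ (card (crit (deletion p K)) + card (crit (link p K)) + card (apex_crit p K))"
    using prod_crit[OF K, of "\<lambda>_. 2::nat"] by (simp add: power_add split_def)
  then show ?thesis by simp
qed

text \<open>Induction on the length of the interval. Members of the link containing
  \<open>p + 1\<close> are counted by the critical pairs of the link. A member \<open>A\<close>
  without \<open>p + 1\<close> is counted by those of the deletion if
  \<open>insert (p + 1) A \<in> K\<close>, and otherwise lies in
  \<open>apex_crit p K\<close>.\<close>

lemma card_crit:
  assumes "shifted_family p q K"
  shows "card (crit K) = card (link p K)"
  using assms
proof (induction "nat (q + 1 - p)" arbitrary: p K rule: less_induct)
  case less
  note K = less.prems
  show ?case
  proof (cases "p \<le> q")
    case False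
    then have "K \<subseteq> {{}}" using K by (auto simp: shifted_family_def)
    then have "crit K = {}" "link p K = {}" by (auto simp: crit_def link_def)
    then show ?thesis by simp
  next
    case True
    define L0 where "L0 = link (p + 1) (deletion p K)"
    define L1 where "L1 = insert (p + 1) ` link (p + 1) (link p K)"
    have IH: "card (crit (deletion p K)) = card L0" "card (crit (link p K)) = card L1"
      using True shifted_family_deletion[OF K] shifted_family_link[OF K]
      by (auto intro!: less.hyps simp: L0_def L1_def card_image[OF inj_on_insert_link])
    \<comment> \<open>Shiftedness enters here: exchanging \<open>p + 1\<close> for \<open>p\<close>
      leads from \<open>insert (p + 1) A\<close> to \<open>insert p A\<close>.\<close>
    have L0: "L0 \<subseteq> link p K"
    proof
      fix A assume "A \<in> L0"
      then show "A \<in> link p K"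
        using deletion_diff_in_link[OF K, of "insert (p + 1) A" "p + 1"] by (auto simp: L0_def link_def)
    qed
    have L1: "L1 = {A \<in> link p K. p + 1 \<in> A}"
      using deletion_un_link[of "link p K" "p + 1"] by (auto simp: deletion_def L1_def)
    have "A \<in> L0 \<longleftrightarrow> A \<notin> L1 \<and> A \<notin> apex_crit p K" if "A \<in> link p K" for A
      using that by (auto simp: L0_def L1 link_def deletion_def apex_crit_def)
    then have eq: "link p K = L0 \<union> L1 \<union> apex_crit p K" "(L0 \<union> L1) \<inter> apex_crit p K = {}" "L0 \<inter> L1 = {}"
      using L0 by (auto simp: L1 apex_crit_def)
    have "finite (link p K)"
      using finite_link finite_shifted_family[OF K] by blast
    then have "finite L0" "finite L1" "finite (apex_crit p K)"
      by (auto simp: eq(1))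
    then have "card (link p K) = card L0 + card L1 + card (apex_crit p K)"
      using eq(2,3) by (simp add: eq(1) card_Un_disjoint)
    then show ?thesis
      by (simp add: card_crit_decomp[OF K] IH)
  qed
qed


section \<open>The spectrum of a shifted family\<close>

text \<open>The entries of \<open>\<partial>\<partial>\<^sup>*\<close>. The set of rows is left open
  because it changes during the recursion.\<close>

definition lap :: "(nat \<Rightarrow> int \<Rightarrow> 'k::field) \<Rightarrow> int set set \<Rightarrow> int set \<Rightarrow> int set \<Rightarrow> 'k" where
  "lap w K G H = (\<Sum>F\<in>K. bdry w G F * bdry w H F)"

lemma bdry_insert_min_link:
  assumes "shifted_family p q K" "H \<in> link p K" "\<forall>a j. w a j \<noteq> 0"
  shows "bdry w G (insert p H) = (if G = H then w 0 p else 0)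
    - (if p \<in> G then w 0 p / w 1 p * bdry (up w) (G - {p}) H else 0)"
proof (rule bdry_insert_min)
  have "H \<subseteq> {p + 1..q}"
    using shifted_family_link[OF assms(1)] assms(2) by (auto simp: shifted_family_def)
  then show "finite H" "\<And>l. l \<in> H \<Longrightarrow> p < l" by (auto intro: finite_subset)
qed fact

lemma finite_mem_shifted_family: "shifted_family p q K \<Longrightarrow> F \<in> K \<Longrightarrow> finite F"
  by (auto simp: shifted_family_def intro: finite_subset)

lemma sum_deletion_link:
  fixes g :: "int set \<Rightarrow> 'c::comm_monoid_add"
  assumes "finite K"
  shows "sum g K = sum g (deletion p K) + (\<Sum>F\<in>link p K. g (insert p F))"
proof -
  have "deletion p K \<inter> insert p ` link p K = {}" by (auto simp: deletion_def)
  then have "sum g (deletion p K \<union> insert p ` link p K) = sum g (deletion p K) + sum g (insert p ` link p K)"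
    using finite_deletion[OF assms] finite_link[OF assms] by (intro sum.union_disjoint) auto
  then show ?thesis
    by (simp flip: deletion_un_link add: sum.reindex[OF inj_on_insert_link])
qed

text \<open>The boundaries \<open>\<partial>(p \<union> H)\<close> with \<open>H\<close> in the link span the image of \<open>\<partial>\<close>, and the coefficients of
  \<open>\<partial>F\<close> with respect to them are read off its rows \<open>H\<close>.\<close>

lemma bdry_expand_link:
  assumes K: "shifted_family p q K" and w: "\<forall>a j. w a j \<noteq> 0" and F: "F \<in> K"
  shows "(\<Sum>H\<in>link p K. bdry w G (insert p H) * bdry w H F) = w 0 p * bdry w G F"
proof -
  note fin = finite_link[OF finite_shifted_family[OF K], of p]
  consider "F \<in> deletion p K" | F' where "F' \<in> link p K" "F = insert p F'"
    using F deletion_un_link[of K p] by blast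
  then show ?thesis
  proof cases
    case 1
    have sub: "\<forall>j\<in>F. F - {j} \<in> link p K"
      using deletion_diff_in_link[OF K 1] by blast
    \<comment> \<open>The parts of the \<open>\<partial>(p \<union> H)\<close> that contain
      \<open>p\<close> add up to a multiple of a twofold boundary of \<open>F\<close>, which
      vanishes.\<close>
    have z: "(\<Sum>H\<in>link p K. bdry (up w) (G - {p}) H * bdry w H F) = 0"
      by (rule bdry_bdry[OF fin finite_mem_shifted_family[OF K F] sub w])
    have "(\<Sum>H\<in>link p K. bdry w G (insert p H) * bdry w H F) =
      (\<Sum>H\<in>link p K. (if G = H then w 0 p * bdry w G F else 0) -
         (if p \<in> G then w 0 p / w 1 p else 0) * (bdry (up w) (G - {p}) H * bdry w H F))"
      by (intro sum.cong refl) (simp add: bdry_insert_min_link[OF K _ w] algebra_simps)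
    also have "\<dots> = (if G \<in> link p K then w 0 p * bdry w G F else 0)"
      using fin by (simp add: sum_subtractf sum_distrib_left[symmetric] z)
    also have "\<dots> = w 0 p * bdry w G F"
    proof -
      have "bdry w G F = 0" if "G \<notin> link p K"
        using that sub by (intro bdry_eq_0) auto
      then show ?thesis by simp
    qed
    finally show ?thesis .
  next
    case 2
    \<comment> \<open>Since \<open>H\<close> avoids \<open>p\<close>,
      \<open>bdry w H (insert p F')\<close> is \<open>w 0 p\<close> for \<open>H = F'\<close> and 0
      otherwise.\<close>
    have "(\<Sum>H\<in>link p K. bdry w G (insert p H) * bdry w H F) =
      (\<Sum>H\<in>link p K. if F' = H then w 0 p * bdry w G F else 0)"
      unfolding 2(2)
      by (intro sum.cong refl) (auto simp: bdry_insert_min_link[OF K 2(1) w] link_def)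
    then show ?thesis using fin 2(1) by simp
  qed
qed

text \<open>Inner products of the columns \<open>\<partial>(p \<union> H)\<close>: rows avoiding
  \<open>p\<close> give the diagonal term, rows containing \<open>p\<close> give
  \<open>b\<^sup>2V\<close>, where the two minus signs cancel.\<close>

lemma sum_bdry_insert_min:
  assumes K: "shifted_family p q K" and w: "\<forall>a j. w a j \<noteq> 0"
    and R: "finite R" "link p K \<subseteq> R" and H: "H \<in> link p K" "H' \<in> link p K"
  defines "R' \<equiv> {G. p \<notin> G \<and> insert p G \<in> R}"
  shows "(\<Sum>G\<in>R. bdry w G (insert p H) * bdry w G (insert p H')) =
    (if H = H' then (w 0 p)\<^sup>2 else 0) +
    (w 0 p / w 1 p)\<^sup>2 * (\<Sum>G\<in>R'. bdry (up w) G H * bdry (up w) G H')"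
proof -
  note b = bdry_insert_min_link[OF K _ w]
  have R': "R' = link p R" by (simp add: R'_def link_def)
  have nH: "p \<notin> H" "p \<notin> H'" using H by (auto simp: link_def)
  have "(\<Sum>G\<in>deletion p R. bdry w G (insert p H) * bdry w G (insert p H')) =
    (\<Sum>G\<in>deletion p R. if H = G then (if H = H' then (w 0 p)\<^sup>2 else 0) else 0)"
    by (intro sum.cong refl) (auto simp: deletion_def b H power2_eq_square)
  also have "\<dots> = (if H = H' then (w 0 p)\<^sup>2 else 0)"
    using R H nH finite_deletion[OF R(1), of p] by (auto simp: deletion_def)
  finally have 1: "(\<Sum>G\<in>deletion p R. bdry w G (insert p H) * bdry w G (insert p H')) = (if H = H' then (w 0 p)\<^sup>2 else 0)" .
  have 2: "(\<Sum>G\<in>link p R. bdry w (insert p G) (insert p H) * bdry w (insert p G) (insert p H')) =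
    (w 0 p / w 1 p)\<^sup>2 * (\<Sum>G\<in>link p R. bdry (up w) G H * bdry (up w) G H')"
    unfolding sum_distrib_left
  proof (rule sum.cong[OF refl])
    fix G assume "G \<in> link p R"
    then have "insert p G - {p} = G" "insert p G \<noteq> H" "insert p G \<noteq> H'"
      using nH by (auto simp: link_def)
    then show "bdry w (insert p G) (insert p H) * bdry w (insert p G) (insert p H') =
       (w 0 p / w 1 p)\<^sup>2 * (bdry (up w) G H * bdry (up w) G H')"
      by (simp add: b H power2_eq_square)
  qed
  show ?thesis
    unfolding sum_deletion_link[OF R(1), where p = p] 1 2 R' ..
qed

text \<open>Computes the product of the exchanged factors, up to a scalar. Faces of the deletion
  give \<open>U\<close>, since their boundaries avoid \<open>p\<close> and so meet
  \<open>\<partial>(p \<union> H')\<close> in row \<open>H'\<close> only. Among the faces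
  \<open>insert p F\<close>, row \<open>H\<close> selects \<open>F = H\<close>, which leaves the
  inner product of two columns.\<close>

lemma sum_lap_insert_min:
  assumes K: "shifted_family p q K" and w: "\<forall>a j. w a j \<noteq> 0"
    and R: "finite R" "\<forall>F\<in>K. \<forall>j\<in>F. F - {j} \<in> R" and H: "H \<in> link p K" "H' \<in> link p K"
  defines "R' \<equiv> {G. p \<notin> G \<and> insert p G \<in> R}"
  shows "(\<Sum>G\<in>R. lap w K H G * bdry w G (insert p H')) = w 0 p *
    ((if H = H' then (w 0 p)\<^sup>2 else 0) + (lap w (deletion p K) H H' +
     (w 0 p / w 1 p)\<^sup>2 * (\<Sum>G\<in>R'. bdry (up w) G H * bdry (up w) G H')))"
proof -
  have LR: "link p K \<subseteq> R"
  proof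
    fix A assume "A \<in> link p K"
    then have "insert p A \<in> K" "insert p A - {p} = A" by (auto simp: link_def)
    then show "A \<in> R" using R(2) by (metis insertI1)
  qed
  note b = bdry_insert_min_link[OF K _ w]
  let ?g = "\<lambda>F. bdry w H F * (\<Sum>G\<in>R. bdry w G F * bdry w G (insert p H'))"
  have "(\<Sum>G\<in>R. lap w K H G * bdry w G (insert p H')) = (\<Sum>F\<in>K. ?g F)"
    unfolding lap_def sum_distrib_right sum_distrib_left
    by (subst sum.swap) (simp add: mult.assoc)
  also have "\<dots> = (\<Sum>F\<in>deletion p K. ?g F) + (\<Sum>F\<in>link p K. ?g (insert p F))"
    by (rule sum_deletion_link[OF finite_shifted_family[OF K]])
  also have "(\<Sum>F\<in>deletion p K. ?g F) = (\<Sum>F\<in>deletion p K. w 0 p * (bdry w H F * bdry w H' F))"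
  proof (rule sum.cong[OF refl])
    fix F assume F: "F \<in> deletion p K"
    have "(\<Sum>G\<in>R. bdry w G F * bdry w G (insert p H')) = (\<Sum>G\<in>R. if H' = G then w 0 p * bdry w H' F else 0)"
    proof (rule sum.cong[OF refl])
      fix G assume "G \<in> R"
      have "bdry w G F = 0" if "p \<in> G"
        using that F by (intro bdry_eq_0) (auto simp: deletion_def)
      then show "bdry w G F * bdry w G (insert p H') = (if H' = G then w 0 p * bdry w H' F else 0)"
        using H(2) by (auto simp: b link_def)
    qed
    also have "\<dots> = w 0 p * bdry w H' F" using R(1) LR H(2) by auto
    finally show "?g F = w 0 p * (bdry w H F * bdry w H' F)" by simp
  qed
  also have "\<dots> = w 0 p * lap w (deletion p K) H H'"
    by (simp add: lap_def sum_distrib_left)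
  also have "(\<Sum>F\<in>link p K. ?g (insert p F)) = (\<Sum>F\<in>link p K. if H = F then w 0 p *
      (\<Sum>G\<in>R. bdry w G (insert p H) * bdry w G (insert p H')) else 0)"
    using H(1) by (intro sum.cong refl) (auto simp: b link_def)
  also have "\<dots> = w 0 p * (\<Sum>G\<in>R. bdry w G (insert p H) * bdry w G (insert p H'))"
    using H(1) finite_link[OF finite_shifted_family[OF K], of p] by simp
  also have "(\<Sum>G\<in>R. bdry w G (insert p H) * bdry w G (insert p H')) =
    (if H = H' then (w 0 p)\<^sup>2 else 0) +
    (w 0 p / w 1 p)\<^sup>2 * (\<Sum>G\<in>R'. bdry (up w) G H * bdry (up w) G H')"
    unfolding R'_def by (rule sum_bdry_insert_min[OF K w R(1) LR H])
  finally show ?thesis by (simp add: algebra_simps)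
qed

text \<open>The generality serves the induction on the interval: \<open>t\<close> absorbs
  \<open>b\<^sup>2\<close>, \<open>x\<close> absorbs the translation by \<open>a\<^sup>2\<close>,
  and the rows \<open>R\<close> become \<open>link p K\<close> for the deletion and
  \<open>R'\<close> for the link. Degree 1 survives translation and keeps \<open>x\<close> nonzero,
  so that its powers cancel.\<close>

lemma char_det_lap:
  fixes w :: "nat \<Rightarrow> int \<Rightarrow> 'k::field" and x :: "'k poly"
  assumes "shifted_family p q K" "\<forall>a j. w a j \<noteq> 0"
    and "finite R" "\<forall>F\<in>K. \<forall>j\<in>F. F - {j} \<in> R" and "degree x = 1"
  shows "char_det x R (\<lambda>G H. t * lap w K G H) * x ^ card (crit K) =
    x ^ card R * (\<Prod>(A, a)\<in>crit K. x - [:t * zval w p A a:])"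
  using assms
proof (induction "nat (q + 1 - p)" arbitrary: p K w R t x rule: less_induct)
  case less
  note K = less.prems(1) and w = less.prems(2) and R = less.prems(3,4) and x = less.prems(5)
  have w': "\<forall>a j. up w a j \<noteq> 0" using w by simp
  show ?case
  proof (cases "p \<le> q")
    case False
    \<comment> \<open>Over an empty interval the only possible face is \<open>{}\<close>, with zero
      boundary and no element to increase.\<close>
    then have "K \<subseteq> {{}}" using K by (auto simp: shifted_family_def)
    then have "crit K = {}" "lap w K G H = 0" for G H
      by (auto simp: crit_def lap_def bdry_def intro!: sum.neutral)
    then show ?thesis using R(1) by (simp add: char_det_zero)
  next
    case True
    define K0 K1 R' where "K0 = deletion p K" and "K1 = link p K" and "R' = {G. p \<notin> G \<and> insert p G \<in> R}"
    define a b x' where "a = w 0 p" and "b = w 0 p / w 1 p" and "x' = x - [:t * a\<^sup>2:]"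
    define V where "V H H' = (\<Sum>G\<in>R'. bdry (up w) G H * bdry (up w) G H')" for H H'
    have a: "a \<noteq> 0" using w by (simp add: a_def)
    have x': "degree x' = 1"
      using x unfolding x'_def diff_conv_add_uminus by (subst degree_add_eq_left) simp_all
    have K0: "shifted_family (p + 1) q K0" and K1: "shifted_family (p + 1) q K1"
      unfolding K0_def K1_def by (fact shifted_family_deletion[OF K] shifted_family_link[OF K])+
    have fin1: "finite K1" by (rule finite_shifted_family[OF K1])
    have "R' = link p R" by (simp add: R'_def link_def)
    then have finR': "finite R'" using finite_link[OF R(1)] by simp
    let ?n = "card K1"

    \<comment> \<open>The factorisation through the link: the columns
      \<open>\<partial>(p \<union> H) / a\<close>, times the rows \<open>H\<close> of the scaled
      Laplacian.\<close>
    have "char_det x R (\<lambda>G H. t * lap w K G H) = char_det x R (\<lambda>G G'. \<Sum>H\<in>K1.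
        (bdry w G (insert p H) / a) * (t * lap w K H G'))"
    proof (rule char_det_cong[OF R(1)])
      fix G G'
      have "(\<Sum>H\<in>K1. (bdry w G (insert p H) / a) * (t * lap w K H G')) =
        t / a * (\<Sum>F\<in>K. (\<Sum>H\<in>K1. bdry w G (insert p H) * bdry w H F) * bdry w G' F)"
        unfolding lap_def sum_distrib_left sum_distrib_right
        by (subst sum.swap) (simp add: mult_ac)
      also have "\<dots> = t * lap w K G G'"
        using a by (simp add: K1_def bdry_expand_link[OF K w] lap_def a_def[symmetric] mult.assoc
            sum_distrib_left[symmetric])
      finally show "t * lap w K G G' = (\<Sum>H\<in>K1. (bdry w G (insert p H) / a) * (t * lap w K H G'))" ..
    qed
    then have "char_det x R (\<lambda>G H. t * lap w K G H) * x ^ ?n = x ^ card R *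
      char_det x K1 (\<lambda>H H'. \<Sum>G\<in>R. (t * lap w K H G) * (bdry w G (insert p H') / a))"
      by (simp only: char_det_Sylvester[OF R(1) fin1])
    \<comment> \<open>After the exchange the diagonal part \<open>t * a\<^sup>2\<close> moves into
      the variable, which becomes \<open>x'\<close>.\<close>
    also have "char_det x K1 (\<lambda>H H'. \<Sum>G\<in>R. (t * lap w K H G) * (bdry w G (insert p H') / a)) =
      char_det x' K1 (\<lambda>H H'. t * lap w K0 H H' + t * b\<^sup>2 * V H H')"
      unfolding x'_def
    proof (rule char_det_shift[OF fin1])
      fix H H' assume H: "H \<in> K1" "H' \<in> K1"
      have "(\<Sum>G\<in>R. (t * lap w K H G) * (bdry w G (insert p H') / a)) =
        t / a * (\<Sum>G\<in>R. lap w K H G * bdry w G (insert p H'))"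
        by (simp add: sum_distrib_left mult.assoc)
      also have "\<dots> = (if H = H' then t * a\<^sup>2 else 0) + (t * lap w K0 H H' + t * b\<^sup>2 * V H H')"
        unfolding sum_lap_insert_min[OF K w R H[unfolded K1_def]]
        using a by (auto simp: a_def b_def K0_def V_def R'_def distrib_left)
      finally show "(\<Sum>G\<in>R. (t * lap w K H G) * (bdry w G (insert p H') / a)) =
        (if H = H' then t * a\<^sup>2 else 0) + (t * lap w K0 H H' + t * b\<^sup>2 * V H H')" .
    qed
    finally have 1: "char_det x R (\<lambda>G H. t * lap w K G H) * x ^ ?n = x ^ card R *
      char_det x' K1 (\<lambda>H H'. t * lap w K0 H H' + t * b\<^sup>2 * V H H')" .

    have 2: "char_det x' K1 (\<lambda>H H'. t * lap w K0 H H' + t * b\<^sup>2 * V H H') * x' ^ ?n =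
      char_det x' K1 (\<lambda>H H'. t * lap w K0 H H') * char_det x' K1 (\<lambda>H H'. t * b\<^sup>2 * V H H')"
    proof (rule char_det_add[OF fin1])
      fix H H'
      \<comment> \<open>The product \<open>UV\<close> contains a twofold boundary, which vanishes
        because all facets of \<open>F \<in> K0\<close> lie in \<open>K1\<close>.\<close>
      have z: "(\<Sum>J\<in>K1. bdry (up w) G J * bdry w J F) = 0" if "F \<in> K0" for F G
        using that bdry_bdry[OF fin1 finite_mem_shifted_family[OF K0 that] _ w]
          deletion_diff_in_link[OF K] by (auto simp: K0_def K1_def)
      let ?c = "\<lambda>F G. t * t * b\<^sup>2 * bdry w H F * bdry (up w) G H'"
      have "(\<Sum>J\<in>K1. t * lap w K0 H J * (t * b\<^sup>2 * V J H')) =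
        (\<Sum>J\<in>K1. \<Sum>F\<in>K0. \<Sum>G\<in>R'. ?c F G * (bdry (up w) G J * bdry w J F))"
      proof (rule sum.cong[OF refl])
        fix J
        have "t * lap w K0 H J * (t * b\<^sup>2 * V J H') = (t * t * b\<^sup>2) * (lap w K0 H J * V J H')"
          by (simp only: mult_ac)
        also have "\<dots> = (\<Sum>F\<in>K0. \<Sum>G\<in>R'. ?c F G * (bdry (up w) G J * bdry w J F))"
          unfolding lap_def V_def sum_product unfolding sum_distrib_left by (simp only: mult_ac)
        finally show "t * lap w K0 H J * (t * b\<^sup>2 * V J H') = (\<Sum>F\<in>K0. \<Sum>G\<in>R'. ?c F G * (bdry (up w) G J * bdry w J F))" .
      qed
      also have "\<dots> = (\<Sum>F\<in>K0. \<Sum>J\<in>K1. \<Sum>G\<in>R'. ?c F G * (bdry (up w) G J * bdry w J F))"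
        by (rule sum.swap)
      also have "\<dots> = (\<Sum>F\<in>K0. \<Sum>G\<in>R'. ?c F G * (\<Sum>J\<in>K1. bdry (up w) G J * bdry w J F))"
        unfolding sum_distrib_left by (intro sum.cong refl sum.swap)
      also have "\<dots> = 0" by (simp add: z)
      finally show "(\<Sum>J\<in>K1. t * lap w K0 H J * (t * b\<^sup>2 * V J H')) = 0" .
    qed

    define P0 P1 where "P0 = (\<Prod>(A, c)\<in>crit K0. x - [:t * zval w p A c:])"
      and "P1 = (\<Prod>(A, c)\<in>crit K1. x - [:t * zval w p (insert p A) c:])"
    have 3: "char_det x' K1 (\<lambda>H H'. t * lap w K0 H H') * x' ^ card (crit K0) = x' ^ ?n * P0"
    proof -
      have "char_det x' K1 (\<lambda>H H'. t * lap w K0 H H') * x' ^ card (crit K0) =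
        x' ^ ?n * (\<Prod>(A, c)\<in>crit K0. x' - [:t * zval w (p + 1) A c:])"
        using True deletion_diff_in_link[OF K]
        by (intro less.hyps K0 w fin1 x') (auto simp: K0_def K1_def)
      also have "(\<Prod>(A, c)\<in>crit K0. x' - [:t * zval w (p + 1) A c:]) = P0"
        unfolding P0_def
      proof (intro prod.cong refl, clarify)
        fix A c assume "(A, c) \<in> crit K0"
        then have "A \<subseteq> {p + 1..q}" "c \<in> A" using K0 by (auto simp: crit_def shifted_family_def)
        then have "A \<subseteq> {p + 1..}" "p \<le> c" by auto
        then show "x' - [:t * zval w (p + 1) A c:] = x - [:t * zval w p A c:]"
          by (simp add: zval_skip[OF _ _ w] x'_def a_def distrib_left)
      qed
      finally show ?thesis .
    qed

    have 4: "char_det x' K1 (\<lambda>H H'. t * b\<^sup>2 * V H H') * x' ^ card (crit K1) = x' ^ ?n * P1"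
    proof -
      have sub: "\<forall>F\<in>K1. \<forall>j\<in>F. F - {j} \<in> R'"
      proof (intro ballI)
        fix F j assume "F \<in> K1" "j \<in> F"
        then have "insert p F - {j} \<in> R" "p \<notin> F" "j \<noteq> p" using R(2) by (auto simp: K1_def link_def)
        moreover have "insert p F - {j} = insert p (F - {j})" using \<open>j \<noteq> p\<close> by auto
        ultimately show "F - {j} \<in> R'" by (simp add: R'_def)
      qed
      \<comment> \<open>The induction hypothesis concerns
        \<open>\<partial>\<partial>\<^sup>*\<close> on \<open>R'\<close>, while \<open>V\<close> is
        \<open>\<partial>\<^sup>*\<partial>\<close> on \<open>K1\<close>; Sylvester's identity in
        \<open>S\<close> connects them.\<close>
      have "char_det x' R' (\<lambda>G H. t * b\<^sup>2 * lap (up w) K1 G H) * x' ^ card (crit K1) =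
        x' ^ card R' * (\<Prod>(A, c)\<in>crit K1. x' - [:t * b\<^sup>2 * zval (up w) (p + 1) A c:])"
        using True by (intro less.hyps K1 w' finR' sub x') auto
      also have "(\<Prod>(A, c)\<in>crit K1. x' - [:t * b\<^sup>2 * zval (up w) (p + 1) A c:]) = P1"
        unfolding P1_def
      proof (intro prod.cong refl, clarify)
        fix A c assume "(A, c) \<in> crit K1"
        then have "A \<subseteq> {p + 1..q}" "c \<in> A" using K1 by (auto simp: crit_def shifted_family_def)
        then have "finite A" "A \<subseteq> {p + 1..}" "p < c" by (auto intro: finite_subset)
        then show "x' - [:t * b\<^sup>2 * zval (up w) (p + 1) A c:] = x - [:t * zval w p (insert p A) c:]"
          by (simp add: zval_insert_min[OF _ _ _ w] x'_def a_def b_def distrib_left mult.assoc)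
      qed
      finally have IH: "char_det x' R' (\<lambda>G H. t * b\<^sup>2 * lap (up w) K1 G H) * x' ^ card (crit K1) =
        x' ^ card R' * P1" .
      have S: "char_det x' R' (\<lambda>G H. t * b\<^sup>2 * lap (up w) K1 G H) * x' ^ ?n =
        x' ^ card R' * char_det x' K1 (\<lambda>H H'. t * b\<^sup>2 * V H H')"
        using char_det_Sylvester[OF finR' fin1, of x' "\<lambda>G H. t * b\<^sup>2 * bdry (up w) G H" "\<lambda>H G. bdry (up w) G H"]
        by (simp add: lap_def V_def sum_distrib_left mult_ac)
      have "x' ^ card R' * (char_det x' K1 (\<lambda>H H'. t * b\<^sup>2 * V H H') * x' ^ card (crit K1)) =
        char_det x' R' (\<lambda>G H. t * b\<^sup>2 * lap (up w) K1 G H) * x' ^ ?n * x' ^ card (crit K1)"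
        unfolding S by (simp only: mult.assoc)
      also have "\<dots> = (char_det x' R' (\<lambda>G H. t * b\<^sup>2 * lap (up w) K1 G H) * x' ^ card (crit K1)) * x' ^ ?n"
        by (simp only: mult_ac)
      also have "\<dots> = x' ^ card R' * (x' ^ ?n * P1)"
        unfolding IH by (simp only: mult_ac)
      finally show ?thesis using x' by auto
    qed

    define e where "e = card (apex_crit p K)"
    \<comment> \<open>The first equation matches the power of \<open>x\<close> in the claim with the
      one from the exchange of factors. The second leaves \<open>e\<close> factors \<open>x'\<close>
      for the critical pairs that increase \<open>p\<close>.\<close>
    have n: "card (crit K) = ?n" "?n = card (crit K0) + card (crit K1) + e"
      using card_crit[OF K] card_crit_decomp[OF K] by (simp_all add: K0_def K1_def e_def)
    have P: "(\<Prod>(A, c)\<in>crit K. x - [:t * zval w p A c:]) = P0 * P1 * x' ^ e"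
    proof -
      have "x - [:t * zval w p (insert p A) p:] = x'" if "A \<in> apex_crit p K" for A
      proof -
        have "insert p A \<subseteq> {p..}"
          using that shifted_family_ge[OF K, of "insert p A"] by (auto simp: apex_crit_def link_def)
        then show ?thesis by (simp add: zval_self[OF _ w] x'_def a_def)
      qed
      then show ?thesis
        unfolding prod_crit[OF K] by (simp add: P0_def P1_def K0_def K1_def e_def)
    qed
    let ?Y = "char_det x' K1 (\<lambda>H H'. t * lap w K0 H H' + t * b\<^sup>2 * V H H')"
    have "x' ^ (?n + card (crit K0) + card (crit K1)) * ?Y =
      (?Y * x' ^ ?n) * x' ^ card (crit K0) * x' ^ card (crit K1)"
      by (simp add: power_add mult_ac)
    also have "\<dots> = (char_det x' K1 (\<lambda>H H'. t * lap w K0 H H') * x' ^ card (crit K0)) *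
       (char_det x' K1 (\<lambda>H H'. t * b\<^sup>2 * V H H') * x' ^ card (crit K1))"
      unfolding 2 by (simp only: mult_ac)
    also have "\<dots> = x' ^ ?n * P0 * (x' ^ ?n * P1)"
      unfolding 3 4 ..
    \<comment> \<open>One of the two factors \<open>x' ^ ?n\<close> is split by the count of
      critical pairs, which releases \<open>x' ^ e\<close>.\<close>
    also have "\<dots> = x' ^ (?n + card (crit K0) + card (crit K1)) * (P0 * P1 * x' ^ e)"
      by (subst (2) n(2)) (simp add: power_add mult_ac)
    finally have "?Y = P0 * P1 * x' ^ e" using x' by auto
    then show ?thesis using 1 by (simp add: n(1) P)
  qed
qed


section \<open>Rational function weights\<close>

lemma raise_nonzero: "u \<noteq> 0 \<Longrightarrow> raise u \<noteq> 0"
  using raise_mult[of u "inverse u"] by (auto simp: raise_1)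

lemma raise_divide: "raise (u / v) = raise u / raise v"
proof (cases "v = 0")
  case False
  then have "raise (u / v) * raise v = raise u" by (simp add: raise_mult[symmetric])
  then show ?thesis using raise_nonzero[OF False] by (simp add: field_simps)
qed (simp add: raise_0)

lemma raise_sum: "raise (\<Sum>a\<in>A. f a) = (\<Sum>a\<in>A. raise (f a))"
  by (induction A rule: infinite_finite_induct) (auto simp: raise_0 raise_add)

lemma funpow_raise_power2: "(raise ^^ r) (u\<^sup>2) = ((raise ^^ r) u)\<^sup>2"
  by (induction r) (simp_all add: power2_eq_square raise_mult)

lemma funpow_raise_divide: "(raise ^^ r) (u / v) = (raise ^^ r) u / (raise ^^ r) v"
  by (induction r) (simp_all add: raise_divide)

lemma funpow_raise_sum: "(raise ^^ r) (\<Sum>a\<in>A. f a) = (\<Sum>a\<in>A. (raise ^^ r) (f a))"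
  by (induction r) (simp_all add: raise_sum)

text \<open>\<open>Suc\<close> converts positions counted from 0 into indices counted from
  1.\<close>

definition indet_up :: "nat \<Rightarrow> nat \<Rightarrow> int \<Rightarrow> ratfun" where
  "indet_up r a j = indet (Suc (r + a)) j"

lemma up_indet_up: "up (indet_up r) = indet_up (Suc r)"
  by (simp add: fun_eq_iff indet_up_def)

lemma indet_up_nonzero: "\<forall>a j. indet_up r a j \<noteq> 0"
proof (intro allI)
  fix a j
  have "Poly_Mapping.single m (1 :: complex) \<noteq> 0" for m :: monomial
    by (metis lookup_single_eq lookup_zero one_neq_zero)
  then show "indet_up r a j \<noteq> 0"
    by (simp add: indet_up_def indet_def Zero_fract_def eq_fract)
qed

text \<open>Reconciles the two forms of raising: the field endomorphism acts on these products as
  the shift of positions.\<close>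

lemma raise_weight: "raise (weight (indet_up r) M) = weight (indet_up (Suc r)) M"
proof -
  have "raise (list_weight (indet_up r) js) = list_weight (indet_up (Suc r)) js" for js
    by (induction js arbitrary: r)
      (simp_all add: raise_1 raise_mult up_indet_up, simp add: indet_up_def raise_indet)
  then show ?thesis by (simp add: weight_def)
qed

lemma list_weight_prod: "list_weight w js = (\<Prod>k<length js. w k (js ! k))"
  by (induction js arbitrary: w) (simp_all add: prod.lessThan_Suc_shift del: prod.lessThan_Suc)

lemma funpow_raise_xwt: "(raise ^^ r) (xwt M) = weight (indet_up r) M"
proof (induction r)
  case 0
  have "size M = length (sorted_list_of_multiset M)"
    by (metis mset_sorted_list_of_multiset size_mset)
  then show ?case by (simp add: xwt_def weight_def list_weight_prod indet_up_def)
qed (simp add: raise_weight)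

text \<open>The bound on \<open>i\<close> keeps \<open>nat\<close> from truncating, so the two
  raising exponents differ by exactly one.\<close>

lemma boundary_coeff_eq_bdry:
  assumes "i \<le> complex_dim \<Omega>"
  shows "boundary_coeff \<Omega> i = bdry (indet_up (nat (complex_dim \<Omega> - i)))"
proof -
  have "nat (complex_dim \<Omega> - i + 1) = Suc (nat (complex_dim \<Omega> - i))" using assms by simp
  then show ?thesis
    unfolding boundary_coeff_def bdry_def fun_eq_iff up_indet_up
    by (simp only: funpow_raise_xwt face_sign_def bsign_def) simp
qed

lemma funpow_raise_zpoly:
  "(raise ^^ r) (zpoly (mset_set {b \<in> A. b < a}) (mset_set {p..a})) = zval (indet_up r) p A a"
proof -
  let ?S = "mset_set {b \<in> A. b < a}"
  have "zpoly ?S (mset_set {p..a}) = (\<Sum>j\<in>{p..a}. (xwt (add_mset j ?S))\<^sup>2 / raise ((xwt ?S)\<^sup>2))"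
    unfolding zpoly_def Xwt_def sum_unfold_sum_mset[symmetric] by (simp add: sum_divide_distrib)
  moreover have "(raise ^^ r) (raise (xwt ?S)) = weight (indet_up (Suc r)) ?S"
    using funpow_raise_xwt[of "Suc r" ?S] by (simp add: funpow_swap1)
  moreover have "raise (u\<^sup>2) = (raise u)\<^sup>2" for u
    by (simp add: power2_eq_square raise_mult)
  ultimately show ?thesis
    by (simp add: zval_def funpow_raise_sum funpow_raise_divide funpow_raise_power2 funpow_raise_xwt
        up_indet_up power_divide)
qed

section \<open>From shifted complexes to shifted families\<close>

lemma shifted_family_faces:
  assumes "shifted_complex p q \<Omega>"
  shows "shifted_family p q (faces \<Omega> i)"
  unfolding shifted_family_def
proof (intro conjI ballI allI impI)
  have sub: "A \<subseteq> {p..q}" if "A \<in> \<Omega>" for A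
    using assms that by (auto simp: shifted_complex_def simplicial_complex_def)
  then show "faces \<Omega> i \<subseteq> Pow {p..q}" by (auto simp: faces_def)
  fix A k j assume A: "A \<in> faces \<Omega> i" and kj: "p \<le> k \<and> k < j \<and> k \<notin> A \<and> j \<in> A"
  have AO: "A \<in> \<Omega>" using A by (simp add: faces_def)
  then have fin: "finite A" and j: "j \<in> {p..q}"
    using sub[OF AO] kj by (auto intro: finite_subset)
  have "A - {j} \<union> {k} \<in> \<Omega>"
    using assms AO kj j unfolding shifted_complex_def by (meson atLeastAtMost_iff less_imp_le order_trans)
  moreover have "card (insert k (A - {j})) = card A"
    using fin kj card_Suc_Diff1[of A j] by (simp del: card_Diff_insert)
  ultimately show "insert k (A - {j}) \<in> faces \<Omega> i"
    using A by (simp add: faces_def face_dim_def)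
qed

text \<open>Exchanging a vertex of \<open>A\<close> for \<open>p\<close> shows that \<open>p\<close>
  does occur in a member.\<close>

lemma min_vertex_shifted_family:
  assumes K: "shifted_family p q K" and A: "A \<in> K" "a \<in> A"
  shows "min_vertex K = p"
  unfolding min_vertex_def
proof (rule Min_eqI)
  show "finite (\<Union>K)"
    using K by (intro finite_subset[of "\<Union>K" "{p..q}"]) (auto simp: shifted_family_def)
  show "p \<le> x" if "x \<in> \<Union>K" for x
    using that shifted_family_ge[OF K] by blast
  show "p \<in> \<Union>K"
  proof (cases "p \<in> A")
    case False
    then have "p < a" using shifted_family_ge[OF K A] A(2) by (cases "p = a") auto
    then have "insert p (A - {a}) \<in> K" using shifted_familyD[OF K A(1)] A(2) False by simp
    then show ?thesis by blast
  qed (use A in blast)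
qed

text \<open>A critical pair determines the element it increases, so replacing \<open>B\<close> by
  that element is injective and keeps multiplicities. If there is a critical pair at all, the least
  vertex is \<open>p\<close>.\<close>

lemma LSG_eq:
  assumes K: "shifted_family p q K"
  shows "LSG K = image_mset (\<lambda>(A, a). ({b \<in> A. b < a}, {p..a})) (mset_set (crit K))"
proof -
  define h where "h = (\<lambda>(A, a). (A, insert (a + 1) (A - {a :: int})))"
  have inc: "increments A (insert (a + 1) (A - {a})) a" if "(A, a) \<in> crit K" for A a
    using that by (simp add: crit_def increments_def)
  have inj: "inj_on h (crit K)"
  proof (rule inj_onI, clarify)
    fix A a A' a' assume "(A, a) \<in> crit K" "(A', a') \<in> crit K" "h (A, a) = h (A', a')"
    then show "A = A' \<and> a = a'"
      using inc increments_unique[of A _ a a'] by (force simp: h_def)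
  qed
  have img: "critical_pairs K = h ` crit K"
    by (auto simp: critical_pairs_def crit_def h_def increments_def image_iff)
  have "long_sig K (h (A, a)) = ({b \<in> A. b < a}, {p..a})" if "(A, a) \<in> crit K" for A a
  proof -
    have "(THE a'. increments A (insert (a + 1) (A - {a})) a') = a"
      using inc[OF that] increments_unique by blast
    moreover have "min_vertex K = p"
      using that by (intro min_vertex_shifted_family[OF K, of A a]) (auto simp: crit_def)
    ultimately show ?thesis by (simp add: long_sig_def h_def)
  qed
  then show ?thesis
    unfolding LSG_def img image_mset_mset_set[OF inj, symmetric] image_mset.compositionality o_def
    using finite_crit[OF K] by (intro image_mset_cong) auto
qed

text \<open>Both sides are the same choice term, so the matrices agree without a permutation of the
  basis.\<close>

lemma enum_faces: "enum (faces \<Omega> i) = face_list \<Omega> i"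
  by (simp add: enum_def face_list_def)

text \<open>The factor \<open>1 *\<close> matches the form of \<open>char_det_lap\<close> with
  \<open>t = 1\<close>.\<close>

lemma char_poly_Lud:
  assumes "simplicial_complex V \<Omega>" and "i \<le> complex_dim \<Omega>"
  shows "Lud \<Omega> (i - 1) \<in> carrier_mat (card (faces \<Omega> (i - 1))) (card (faces \<Omega> (i - 1)))"
    and "char_poly (Lud \<Omega> (i - 1)) = char_det [:0, 1:] (faces \<Omega> (i - 1))
      (\<lambda>G H. 1 * lap (indet_up (nat (complex_dim \<Omega> - i))) (faces \<Omega> i) G H)"
proof -
  have fin: "finite (faces \<Omega> k)" for k
    using face_list(2)[OF assms(1), of k] by (metis finite_set)
  have len: "length (face_list \<Omega> k) = card (faces \<Omega> k)" for k
    using enum(3)[OF fin] by (simp add: enum_faces)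
  let ?b = "bdry (indet_up (nat (complex_dim \<Omega> - i)))"
  have B: "boundary \<Omega> i = fun_mat (faces \<Omega> (i - 1)) (faces \<Omega> i) ?b"
    by (simp add: boundary_def fun_mat_def enum_faces len boundary_coeff_eq_bdry[OF assms(2)])
  have "transpose_mat (boundary \<Omega> i) = fun_mat (faces \<Omega> i) (faces \<Omega> (i - 1)) (\<lambda>F G. ?b G F)"
    unfolding B by (rule eq_matI) auto
  then have "Lud \<Omega> (i - 1) = fun_mat (faces \<Omega> (i - 1)) (faces \<Omega> (i - 1))
      (\<lambda>G H. 1 * lap (indet_up (nat (complex_dim \<Omega> - i))) (faces \<Omega> i) G H)"
    by (simp add: Lud_def B fun_mat_mult[OF fin] lap_def)
  then show "Lud \<Omega> (i - 1) \<in> carrier_mat (card (faces \<Omega> (i - 1))) (card (faces \<Omega> (i - 1)))"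
    and "char_poly (Lud \<Omega> (i - 1)) = char_det [:0, 1:] (faces \<Omega> (i - 1))
      (\<lambda>G H. 1 * lap (indet_up (nat (complex_dim \<Omega> - i))) (faces \<Omega> i) G H)"
    by (simp_all only: fun_mat_carrier char_poly_fun_mat[OF fin])
qed

lemma proots_prod_linear:
  assumes "finite A"
  shows "proots (\<Prod>a\<in>A. [:- f a, 1:]) = image_mset f (mset_set A)"
  using assms by (induction A) (simp_all add: proots_mult del: mult_pCons_left)

theorem theorem1p5:
  fixes p q d i :: int and \<Sigma> :: "int set set"
  assumes "shifted_complex p q \<Sigma>"
    and "complex_dim \<Sigma> = d"
    and "0 \<le> i" and "i \<le> d"
  shows "eq_mod_zeros (Sud \<Sigma> (i - 1))
    (image_mset
      (\<lambda>(S, T). to_ac ((raise ^^ nat (d - i)) (zpoly (mset_set S) (mset_set T))))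
      (LSG (faces \<Sigma> i)))"
proof -
  interpret to_ac: comm_ring_hom "to_ac :: ratfun \<Rightarrow> _"
    by unfold_locales auto
  interpret map_poly_to_ac: map_poly_comm_ring_hom "to_ac :: ratfun \<Rightarrow> _" ..
  let ?K = "faces \<Sigma> i" and ?R = "faces \<Sigma> (i - 1)" and ?w = "indet_up (nat (d - i))"
  define z where "z = (\<lambda>(A, a). zval ?w p A a)"
  have sc: "simplicial_complex {p..q} \<Sigma>"
    using assms(1) by (simp add: shifted_complex_def)
  have K: "shifted_family p q ?K" and R: "finite ?R"
    using shifted_family_faces[OF assms(1)] finite_shifted_family by blast+
  have sub: "\<forall>F\<in>?K. \<forall>j\<in>F. F - {j} \<in> ?R"
  proof (intro ballI)
    fix F j assume F: "F \<in> ?K" and j: "j \<in> F"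
    have "F - {j} \<in> \<Sigma>" using sc F by (auto simp: simplicial_complex_def faces_def)
    moreover have "card F = Suc (card (F - {j}))"
      using finite_mem_shifted_family[OF K F] j by (metis card_Suc_Diff1)
    ultimately show "F - {j} \<in> ?R" using F by (simp add: faces_def face_dim_def)
  qed
  have Lud: "Lud \<Sigma> (i - 1) \<in> carrier_mat (card ?R) (card ?R)"
    "char_poly (Lud \<Sigma> (i - 1)) = char_det [:0, 1:] ?R (\<lambda>G H. 1 * lap ?w ?K G H)"
    using char_poly_Lud[OF sc, of i] assms(2,4) by auto
  define P where "P = char_poly (map_mat to_ac (Lud \<Sigma> (i - 1)))"
  have P: "P = map_poly to_ac (char_poly (Lud \<Sigma> (i - 1)))"
    unfolding P_def by (rule to_ac.char_poly_hom[OF Lud(1)])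
  have "char_poly (Lud \<Sigma> (i - 1)) * [:0, 1:] ^ card (crit ?K) =
      [:0, 1:] ^ card ?R * (\<Prod>c\<in>crit ?K. [:- z c, 1:])"
    using char_det_lap[OF K indet_up_nonzero R sub, where x = "[:0, 1:]" and t = 1]
    by (simp add: Lud(2) z_def split_def)
  from arg_cong[where f = "map_poly to_ac", OF this]
  have eq: "P * [:0, 1:] ^ card (crit ?K) =
      [:0, 1:] ^ card ?R * (\<Prod>c\<in>crit ?K. [:- to_ac (z c), 1:])"
    by (simp add: P map_poly_to_ac.hom_mult map_poly_to_ac.hom_power map_poly_to_ac.hom_prod)
  \<comment> \<open>Roots of a product are collected factor by factor only when the factors are
    nonzero.\<close>
  have nz: "(\<Prod>c\<in>crit ?K. [:- to_ac (z c), 1:]) \<noteq> 0"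
    using finite_crit[OF K] by simp
  then have "P \<noteq> 0" using eq by auto
  have "proots P + repeat_mset (card (crit ?K)) {#0#} =
      repeat_mset (card ?R) {#0#} + image_mset (\<lambda>c. to_ac (z c)) (mset_set (crit ?K))"
    using arg_cong[where f = proots, OF eq] \<open>P \<noteq> 0\<close> nz finite_crit[OF K]
    by (simp add: proots_mult proots_power proots_prod_linear del: prod_zero_iff)
  \<comment> \<open>The powers of the variable contribute copies of 0 only.\<close>
  then have "count (proots P) c = count (image_mset (\<lambda>c. to_ac (z c)) (mset_set (crit ?K))) c"
    if "c \<noteq> 0" for c
    using that by (auto dest!: arg_cong[where f = "\<lambda>M. count M c"])
  moreover have "image_mset (\<lambda>(S, T). to_ac ((raise ^^ nat (d - i)) (zpoly (mset_set S) (mset_set T)))) (LSG ?K)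
    = image_mset (\<lambda>c. to_ac (z c)) (mset_set (crit ?K))"
    by (simp add: LSG_eq[OF K] image_mset.compositionality o_def split_def z_def funpow_raise_zpoly)
  ultimately show ?thesis
    by (simp add: eq_mod_zeros_def Sud_def P_def)
qed

end
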